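(* Let $(M,J,g)$ be an almost complex manifold with Norden metric, with Levi-Civita connection $\nabla$ of $g$ and $F(X,Y,Z)=g((\nabla_XJ)Y,Z)$. Then there exists a 4-parametric family of almost complex connections on $M$: for all $t_1,t_2,t_3,t_4\in\mathbb{R}$, the linear connection $\nabla'$ defined by $$ \begin{aligned} g\big(\nabla'_XY-\nabla_XY,Z\big)={}&\tfrac12F(X,JY,Z)+t_1\{F(Y,X,Z)+F(JY,JX,Z)\}\\ &+t_2\{F(Y,JX,Z)-F(JY,X,Z)\}+t_3\{F(Z,X,Y)+F(JZ,JX,Y)\}\\ &+t_4\{F(Z,JX,Y)-F(JZ,X,Y)\} \end{aligned} $$ for all vector fields $X,Y,Z$ satisfies $\nabla'J=0$, and its torsion tensor $T$ is given by $$ \begin{aligned} T(X,Y,Z)={}&t_1\{F(Y,X,Z)-F(X,Y,Z)+F(JY,JX,Z)-F(JX,JY,Z)\}\\ &+\big(\tfrac12-t_2\big)\{F(X,JY,Z)-F(Y,JX,Z)\}+t_2\{F(JX,Y,Z)-F(JY,X,Z)\}\\ &+2t_3F(JZ,JX,Y)+2t_4F(Z,JX,Y). \end{aligned} $$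
   Context: An almost complex manifold with Norden metric $(M,J,g)$ is a $2n$-dimensional smooth manifold with an almost complex structure $J$ ($J^2X=-X$) and a pseudo-Riemannian metric $g$ such that $g(JX,JY)=-g(X,Y)$ for all vector fields $X,Y$ (so $g$ has signature $(n,n)$). A linear connection $\nabla'$ on $(M,J)$ is called almost complex if $\nabla'J=0$. The torsion of $\nabla'$ is $T(X,Y)=\nabla'_XY-\nabla'_YX-[X,Y]$ and $T(X,Y,Z)=g(T(X,Y),Z)$. *)

theory Defs
  imports "HOL-Analysis.Analysis" "HOL-Library.Function_Algebras"
begin

section \<open>Smooth manifolds\<close>

text \<open>The differentiability class \<open>C\<^sup>k\<close>, for maps on an open subset \<open>S\<close> of a Euclidean space.\<close>

primrec Ck_on :: "nat \<Rightarrow> 'e::euclidean_space set \<Rightarrow> ('e \<Rightarrow> 'b::real_normed_vector) \<Rightarrow> bool" where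
  "Ck_on 0 S f \<longleftrightarrow> continuous_on S f"
| "Ck_on (Suc k) S f \<longleftrightarrow>
     (\<forall>x\<in>S. f differentiable (at x)) \<and> (\<forall>v. Ck_on k S (\<lambda>x. frechet_derivative f (at x) v))"

definition smooth_on :: "'e::euclidean_space set \<Rightarrow> ('e \<Rightarrow> 'b::real_normed_vector) \<Rightarrow> bool" where
  "smooth_on S f \<longleftrightarrow> (\<forall>k. Ck_on k S f)"

text \<open>The manifold is the whole type \<open>'a\<close> (Hausdorff and second countable); its charts
  \<open>(U, \<phi>)\<close> take values in the Euclidean space \<open>'e\<close>, so its dimension is \<open>DIM('e)\<close>.\<close>

type_synonym ('a, 'e) chart = "'a set \<times> ('a \<Rightarrow> 'e)"

definition is_chart ::
    "('a::{second_countable_topology, t2_space}, 'e::euclidean_space) chart \<Rightarrow> bool" where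
  "is_chart = (\<lambda>(U, \<phi>). open U \<and> open (\<phi> ` U) \<and> homeomorphism U (\<phi> ` U) \<phi> (inv_into U \<phi>))"

definition smooth_atlas ::
    "('a::{second_countable_topology, t2_space}, 'e::euclidean_space) chart set \<Rightarrow> bool" where
  "smooth_atlas A \<longleftrightarrow>
     (\<forall>c\<in>A. is_chart c) \<and> (\<Union>(U, \<phi>)\<in>A. U) = UNIV \<and>
     (\<forall>(U, \<phi>)\<in>A. \<forall>(V, \<psi>)\<in>A. smooth_on (\<phi> ` (U \<inter> V)) (\<psi> \<circ> inv_into U \<phi>))"

definition smooth_functions ::
    "('a::{second_countable_topology, t2_space}, 'e::euclidean_space) chart set \<Rightarrow> ('a \<Rightarrow> real) set"
  where "smooth_functions A = {f. \<forall>(U, \<phi>)\<in>A. smooth_on (\<phi> ` U) (f \<circ> inv_into U \<phi>)}"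


section \<open>Vector fields\<close>

text \<open>Smooth vector fields are the derivations of the algebra of smooth functions; \<open>X f p\<close> is the
  derivative of \<open>f\<close> in the direction \<open>X\<^sub>p\<close>. They are extended by 0 to non-smooth functions, so that
  equality of vector fields is equality in HOL. The operations \<open>+\<close>, \<open>-\<close>, \<open>*\<close> and \<open>0\<close> on functions
  and vector fields are the pointwise ones.\<close>

type_synonym 'a vfield = "('a \<Rightarrow> real) \<Rightarrow> ('a \<Rightarrow> real)"

definition vector_fields ::
    "('a::{second_countable_topology, t2_space}, 'e::euclidean_space) chart set \<Rightarrow> 'a vfield set"
  where "vector_fields A = {X.
     (\<forall>f\<in>smooth_functions A. X f \<in> smooth_functions A) \<and>
     (\<forall>f. f \<notin> smooth_functions A \<longrightarrow> X f = 0) \<and>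
     (\<forall>f\<in>smooth_functions A. \<forall>h\<in>smooth_functions A. X (f + h) = X f + X h) \<and>
     (\<forall>c. \<forall>f\<in>smooth_functions A. X (\<lambda>p. c * f p) = (\<lambda>p. c * X f p)) \<and>
     (\<forall>f\<in>smooth_functions A. \<forall>h\<in>smooth_functions A. X (f * h) = f * X h + h * X f)}"

definition fscale :: "('a \<Rightarrow> real) \<Rightarrow> 'a vfield \<Rightarrow> 'a vfield"  (infixr \<open>\<odot>\<close> 75) where
  "f \<odot> X = (\<lambda>h. f * X h)"

definition lie_bracket :: "'a vfield \<Rightarrow> 'a vfield \<Rightarrow> 'a vfield" where
  "lie_bracket X Y = (\<lambda>f. X (Y f) - Y (X f))"


section \<open>Metrics, almost complex structures and connections\<close>

text \<open>Tensor fields are maps on vector fields that are linear over the smooth functions. Only the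
  values on \<open>vector_fields A\<close> matter.\<close>

text \<open>In the last clause, nondegeneracy of \<open>g\<close> at each point \<open>p\<close>, the conclusion says \<open>X\<^sub>p = 0\<close>.\<close>

definition pseudo_riemannian_metric ::
    "('a::{second_countable_topology, t2_space}, 'e::euclidean_space) chart set
      \<Rightarrow> ('a vfield \<Rightarrow> 'a vfield \<Rightarrow> 'a \<Rightarrow> real) \<Rightarrow> bool" where
  "pseudo_riemannian_metric A g \<longleftrightarrow>
     (\<forall>X\<in>vector_fields A. \<forall>Y\<in>vector_fields A. g X Y \<in> smooth_functions A \<and> g X Y = g Y X) \<and>
     (\<forall>X\<in>vector_fields A. \<forall>X'\<in>vector_fields A. \<forall>Y\<in>vector_fields A.
        g (X + X') Y = g X Y + g X' Y) \<and>
     (\<forall>f\<in>smooth_functions A. \<forall>X\<in>vector_fields A. \<forall>Y\<in>vector_fields A.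
        g (f \<odot> X) Y = f * g X Y) \<and>
     (\<forall>p. \<forall>X\<in>vector_fields A.
        (\<forall>Y\<in>vector_fields A. g X Y p = 0) \<longrightarrow> (\<forall>f\<in>smooth_functions A. X f p = 0))"

definition almost_complex_structure ::
    "('a::{second_countable_topology, t2_space}, 'e::euclidean_space) chart set
      \<Rightarrow> ('a vfield \<Rightarrow> 'a vfield) \<Rightarrow> bool" where
  "almost_complex_structure A J \<longleftrightarrow>
     (\<forall>X\<in>vector_fields A. J X \<in> vector_fields A) \<and>
     (\<forall>X\<in>vector_fields A. \<forall>Y\<in>vector_fields A. J (X + Y) = J X + J Y) \<and>
     (\<forall>f\<in>smooth_functions A. \<forall>X\<in>vector_fields A. J (f \<odot> X) = f \<odot> J X) \<and>
     (\<forall>X\<in>vector_fields A. J (J X) = - X)"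

definition almost_complex_norden_manifold ::
    "nat \<Rightarrow> ('a::{second_countable_topology, t2_space}, 'e::euclidean_space) chart set
      \<Rightarrow> ('a vfield \<Rightarrow> 'a vfield) \<Rightarrow> ('a vfield \<Rightarrow> 'a vfield \<Rightarrow> 'a \<Rightarrow> real) \<Rightarrow> bool" where
  "almost_complex_norden_manifold n A J g \<longleftrightarrow>
     smooth_atlas A \<and> DIM('e) = 2 * n \<and>
     almost_complex_structure A J \<and> pseudo_riemannian_metric A g \<and>
     (\<forall>X\<in>vector_fields A. \<forall>Y\<in>vector_fields A. g (J X) (J Y) = - g X Y)"

definition linear_connection ::
    "('a::{second_countable_topology, t2_space}, 'e::euclidean_space) chart set
      \<Rightarrow> ('a vfield \<Rightarrow> 'a vfield \<Rightarrow> 'a vfield) \<Rightarrow> bool" where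
  "linear_connection A D \<longleftrightarrow>
     (\<forall>X\<in>vector_fields A. \<forall>Y\<in>vector_fields A. D X Y \<in> vector_fields A) \<and>
     (\<forall>X\<in>vector_fields A. \<forall>X'\<in>vector_fields A. \<forall>Y\<in>vector_fields A.
        D (X + X') Y = D X Y + D X' Y) \<and>
     (\<forall>f\<in>smooth_functions A. \<forall>X\<in>vector_fields A. \<forall>Y\<in>vector_fields A.
        D (f \<odot> X) Y = f \<odot> D X Y) \<and>
     (\<forall>X\<in>vector_fields A. \<forall>Y\<in>vector_fields A. \<forall>Y'\<in>vector_fields A.
        D X (Y + Y') = D X Y + D X Y') \<and>
     (\<forall>f\<in>smooth_functions A. \<forall>X\<in>vector_fields A. \<forall>Y\<in>vector_fields A.
        D X (f \<odot> Y) = X f \<odot> Y + f \<odot> D X Y)"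

definition torsion ::
    "('a vfield \<Rightarrow> 'a vfield \<Rightarrow> 'a vfield) \<Rightarrow> 'a vfield \<Rightarrow> 'a vfield \<Rightarrow> 'a vfield" where
  "torsion D X Y = D X Y - D Y X - lie_bracket X Y"

definition levi_civita_connection ::
    "('a::{second_countable_topology, t2_space}, 'e::euclidean_space) chart set
      \<Rightarrow> ('a vfield \<Rightarrow> 'a vfield \<Rightarrow> 'a \<Rightarrow> real) \<Rightarrow> ('a vfield \<Rightarrow> 'a vfield \<Rightarrow> 'a vfield) \<Rightarrow> bool" where
  "levi_civita_connection A g D \<longleftrightarrow>
     linear_connection A D \<and>
     (\<forall>X\<in>vector_fields A. \<forall>Y\<in>vector_fields A. torsion D X Y = 0) \<and>
     (\<forall>X\<in>vector_fields A. \<forall>Y\<in>vector_fields A. \<forall>Z\<in>vector_fields A.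
        X (g Y Z) = g (D X Y) Z + g Y (D X Z))"

text \<open>The covariant derivative of an endomorphism field: \<open>(\<nabla>\<^sub>X J) Y\<close>.\<close>

definition cov_deriv_endo ::
    "('a vfield \<Rightarrow> 'a vfield \<Rightarrow> 'a vfield) \<Rightarrow> ('a vfield \<Rightarrow> 'a vfield)
      \<Rightarrow> 'a vfield \<Rightarrow> 'a vfield \<Rightarrow> 'a vfield" where
  "cov_deriv_endo D J X Y = D X (J Y) - J (D X Y)"

definition almost_complex_connection ::
    "('a::{second_countable_topology, t2_space}, 'e::euclidean_space) chart set
      \<Rightarrow> ('a vfield \<Rightarrow> 'a vfield) \<Rightarrow> ('a vfield \<Rightarrow> 'a vfield \<Rightarrow> 'a vfield) \<Rightarrow> bool" where
  "almost_complex_connection A J D \<longleftrightarrow>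
     linear_connection A D \<and>
     (\<forall>X\<in>vector_fields A. \<forall>Y\<in>vector_fields A. cov_deriv_endo D J X Y = 0)"

definition fundamental_tensor ::
    "('a vfield \<Rightarrow> 'a vfield \<Rightarrow> 'a \<Rightarrow> real) \<Rightarrow> ('a vfield \<Rightarrow> 'a vfield)
      \<Rightarrow> ('a vfield \<Rightarrow> 'a vfield \<Rightarrow> 'a vfield)
      \<Rightarrow> 'a vfield \<Rightarrow> 'a vfield \<Rightarrow> 'a vfield \<Rightarrow> 'a \<Rightarrow> real" where
  "fundamental_tensor g J D X Y Z = g (cov_deriv_endo D J X Y) Z"

text \<open>The defining equation, for all vector fields, of the member \<open>D'\<close> of the family with parameters
  \<open>t1, t2, t3, t4\<close>, where \<open>D\<close> is the Levi-Civita connection.\<close>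

definition family_equation ::
    "('a::{second_countable_topology, t2_space}, 'e::euclidean_space) chart set
      \<Rightarrow> ('a vfield \<Rightarrow> 'a vfield \<Rightarrow> 'a \<Rightarrow> real) \<Rightarrow> ('a vfield \<Rightarrow> 'a vfield)
      \<Rightarrow> ('a vfield \<Rightarrow> 'a vfield \<Rightarrow> 'a vfield) \<Rightarrow> real \<Rightarrow> real \<Rightarrow> real \<Rightarrow> real
      \<Rightarrow> ('a vfield \<Rightarrow> 'a vfield \<Rightarrow> 'a vfield) \<Rightarrow> bool" where
  "family_equation A g J D t1 t2 t3 t4 D' \<longleftrightarrow>
     (let F = fundamental_tensor g J D in
      \<forall>X\<in>vector_fields A. \<forall>Y\<in>vector_fields A. \<forall>Z\<in>vector_fields A. \<forall>p.
        g (D' X Y - D X Y) Z p =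
          1/2 * F X (J Y) Z p
          + t1 * (F Y X Z p + F (J Y) (J X) Z p)
          + t2 * (F Y (J X) Z p - F (J Y) X Z p)
          + t3 * (F Z X Y p + F (J Z) (J X) Y p)
          + t4 * (F Z (J X) Y p - F (J Z) X Y p))"

end

theory Submission
  imports Defs "Jordan_Normal_Form.Determinant"
begin

text \<open>The right-hand side of the defining equation is, for fixed \<open>X\<close> and \<open>Y\<close>, a one-form in \<open>Z\<close>. The
  \<open>t\<^sub>3\<close> and \<open>t\<^sub>4\<close> terms have \<open>Z\<close> as the direction of differentiation, so a vector field representing the
  one-form through \<open>g\<close> can only come from the musical isomorphism. As vector fields are derivations, that
  isomorphism needs Hadamard's lemma (derivations are combinations of coordinate fields), bump functions
  (locality) and Cramer's rule for the Gram matrix of a local frame. Everything else follows from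
  \<open>F(X,Y,Z) = F(X,Z,Y)\<close> and \<open>F(X,Y,JZ) = - F(X,JY,Z)\<close>.\<close>

section \<open>Calculus of \<open>C\<^sup>k\<close> maps\<close>

text \<open>Write S(X,Y,Z) for the right-hand side of the defining equation. Then nabla'J = 0
  amounts to S(X,Y,JZ) - S(X,JY,Z) = F(X,Y,Z). The term 1/2 F(X,JY,Z) is a particular solution of
  this linear equation, since either side contributes one half, and the four brackets solve the
  homogeneous equation; hence the constant 1/2 and the free parameters. Two facts shape the
  analysis: a vector field acts only on functions that are smooth on the whole manifold, and
  nondegeneracy at a point is tested against global fields. So local objects (coordinates,
  coordinate fields, Hadamard coefficients) are cut off to global ones before any vector field or
  one-form meets them. For the same reason the Gram matrix is not inverted: its inverse would live
  only where the determinant is nonzero, whereas the adjugate has globally smooth entries, and the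
  division by the determinant can wait until values at a point are compared.\<close>

lemma Ck_on_cong:
  assumes "open S" "\<And>x. x \<in> S \<Longrightarrow> f x = g x" "Ck_on k S f"
  shows "Ck_on k S g"
  using assms(2,3)
proof (induction k arbitrary: f g)
  case 0
  then show ?case by (metis Ck_on.simps(1) continuous_on_cong)
next
  case (Suc k)
  have D: "(g has_derivative frechet_derivative f (at x)) (at x)" if x: "x \<in> S" for x
  proof (rule has_derivative_transform_within_open[OF _ assms(1) x])
    show "(f has_derivative frechet_derivative f (at x)) (at x)"
      using Suc.prems(2) x by (simp add: frechet_derivative_works)
  qed (rule Suc.prems(1))
  have "Ck_on k S (\<lambda>x. frechet_derivative g (at x) v)" for v
    by (rule Suc.IH[of "\<lambda>x. frechet_derivative f (at x) v"])
      (use Suc.prems(2) frechet_derivative_at[OF D] in auto)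
  then show ?case using D by (auto simp: differentiable_def)
qed

text \<open>Trades the opaque \<open>frechet_derivative\<close> for an explicit formula
  \<open>f'\<close>. Each closure rule then consists of a differentiation rule and an induction on
  \<open>k\<close>.\<close>

lemma Ck_on_SucI:
  assumes "open S" "\<And>x. x \<in> S \<Longrightarrow> (f has_derivative f' x) (at x)" "\<And>v. Ck_on k S (\<lambda>x. f' x v)"
  shows "Ck_on (Suc k) S f"
proof -
  have "Ck_on k S (\<lambda>x. frechet_derivative f (at x) v)" for v
    by (rule Ck_on_cong[OF assms(1) _ assms(3)]) (simp add: frechet_derivative_at[OF assms(2), symmetric])
  then show ?thesis using assms(2) by (auto simp: differentiable_def)
qed

lemma Ck_on_has_derivative:
  assumes "Ck_on (Suc k) S f" "x \<in> S"
  shows "(f has_derivative frechet_derivative f (at x)) (at x)"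
  using assms by (simp add: frechet_derivative_works)

lemma Ck_on_subset: "Ck_on k S f \<Longrightarrow> T \<subseteq> S \<Longrightarrow> Ck_on k T f"
  by (induction k arbitrary: f) (auto intro: continuous_on_subset)

lemma Ck_on_local:
  "(\<And>x. x \<in> S \<Longrightarrow> \<exists>T. open T \<and> x \<in> T \<and> Ck_on k T f) \<Longrightarrow> Ck_on k S f"
proof (induction k arbitrary: f)
  case 0
  have "isCont f x" if "x \<in> S" for x
    using 0[OF that] continuous_on_eq_continuous_at by auto
  then show ?case by (simp add: continuous_at_imp_continuous_on)
next
  case (Suc k)
  have "Ck_on k S (\<lambda>x. frechet_derivative f (at x) v)" for v
    using Suc.prems by (intro Suc.IH) (fastforce simp: Ck_on.simps(2))
  moreover have "f differentiable (at x)" if "x \<in> S" for x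
    using Suc.prems[OF that] by (auto simp: Ck_on.simps(2))
  ultimately show ?case by simp
qed

lemma Ck_on_imp_continuous_on: "Ck_on k S f \<Longrightarrow> continuous_on S f"
  by (cases k)
    (auto intro!: continuous_at_imp_continuous_on dest: differentiable_imp_continuous_within)

text \<open>The recursion speaks only of derivatives, but the product, inverse and chain rules keep
  undifferentiated factors, to which the induction hypothesis applies only after lowering the
  class.\<close>

lemma Ck_on_SucD: "Ck_on (Suc k) S f \<Longrightarrow> Ck_on k S f"
proof (induction k arbitrary: f)
  case 0
  then show ?case using Ck_on_imp_continuous_on by (metis Ck_on.simps(1))
next
  case (Suc k)
  have "\<forall>x\<in>S. f differentiable (at x)"
    and "Ck_on (Suc k) S (\<lambda>x. frechet_derivative f (at x) v)" for v
    using Suc.prems unfolding Ck_on.simps(2)[of "Suc k"] by blast+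
  then show ?case
    using Suc.IH by (intro Ck_on.simps(2)[THEN iffD2] conjI) blast+
qed

lemma Ck_on_const: "open S \<Longrightarrow> Ck_on k S (\<lambda>x. c)"
proof (induction k arbitrary: c)
  case (Suc k)
  then show ?case by (intro Ck_on_SucI[where f' = "\<lambda>x v. 0"]) auto
qed simp

lemma Ck_on_bounded_linear:
  assumes "bounded_linear L" "open S" "Ck_on k S f"
  shows "Ck_on k S (\<lambda>x. L (f x))"
  using assms(3)
proof (induction k arbitrary: f)
  case 0
  then show ?case by (simp add: bounded_linear.continuous_on[OF assms(1)])
next
  case (Suc k)
  show ?case
    by (rule Ck_on_SucI[OF assms(2)
          bounded_linear.has_derivative[OF assms(1) Ck_on_has_derivative[OF Suc.prems]]])
      (use Suc in auto)
qed

lemma Ck_on_add: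
  assumes "open S" "Ck_on k S f" "Ck_on k S g"
  shows "Ck_on k S (\<lambda>x. f x + g x)"
  using assms(2,3)
proof (induction k arbitrary: f g)
  case 0
  then show ?case by (simp add: continuous_on_add)
next
  case (Suc k)
  show ?case
    by (rule Ck_on_SucI[OF assms(1) has_derivative_add[OF
            Ck_on_has_derivative[OF Suc.prems(1)] Ck_on_has_derivative[OF Suc.prems(2)]]])
      (use Suc in auto)
qed

lemma Ck_on_sum:
  assumes "open S" "\<And>i. i \<in> I \<Longrightarrow> Ck_on k S (f i)"
  shows "Ck_on k S (\<lambda>x. \<Sum>i\<in>I. f i x)"
  using assms(2)
  by (induction I rule: infinite_finite_induct) (auto intro!: Ck_on_const Ck_on_add assms(1))

lemma Ck_on_mult:
  fixes f g :: "'e::euclidean_space \<Rightarrow> real"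
  assumes "open S" "Ck_on k S f" "Ck_on k S g"
  shows "Ck_on k S (\<lambda>x. f x * g x)"
  using assms(2,3)
proof (induction k arbitrary: f g)
  case 0
  then show ?case by (simp add: continuous_on_mult)
next
  case (Suc k)
  show ?case
    by (rule Ck_on_SucI[OF assms(1) has_derivative_mult[OF
            Ck_on_has_derivative[OF Suc.prems(1)] Ck_on_has_derivative[OF Suc.prems(2)]]])
      (use Suc.prems Ck_on_SucD[OF Suc.prems(1)] Ck_on_SucD[OF Suc.prems(2)] in
        \<open>auto intro!: Ck_on_add Suc.IH assms(1)\<close>)
qed

text \<open>The derivative of 1/f is a product of 1/f, 1/f and f', so the induction closes with
  \<open>f\<close> fixed.\<close>

lemma Ck_on_inverse:
  fixes f :: "'e::euclidean_space \<Rightarrow> real"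
  assumes "open S" "Ck_on k S f" "\<And>x. x \<in> S \<Longrightarrow> f x \<noteq> 0"
  shows "Ck_on k S (\<lambda>x. inverse (f x))"
  using assms(2)
proof (induction k)
  case 0
  then show ?case using assms(3) by (auto intro: continuous_on_inverse)
next
  case (Suc k)
  have I: "Ck_on k S (\<lambda>x. inverse (f x))"
    by (rule Suc.IH[OF Ck_on_SucD[OF Suc.prems]])
  show ?case
  proof (rule Ck_on_SucI[OF assms(1)])
    show "((\<lambda>x. inverse (f x)) has_derivative
        (\<lambda>v. - (inverse (f x) * frechet_derivative f (at x) v * inverse (f x)))) (at x)"
      if "x \<in> S" for x
      by (rule Deriv.has_derivative_inverse[OF assms(3)[OF that] Ck_on_has_derivative[OF Suc.prems that]])
    show "Ck_on k S (\<lambda>x. - (inverse (f x) * frechet_derivative f (at x) v * inverse (f x)))" for v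
      using Suc.prems
      by (intro Ck_on_bounded_linear[OF bounded_linear_minus[OF bounded_linear_ident]] Ck_on_mult assms(1) I)
        auto
  qed
qed

lemma Ck_on_compose:
  fixes f :: "'e::euclidean_space \<Rightarrow> real" and h :: "'d::euclidean_space \<Rightarrow> 'e"
  assumes "open S" "open T" "h ` S \<subseteq> T" "Ck_on k T f" "Ck_on k S h"
  shows "Ck_on k S (\<lambda>x. f (h x))"
  using assms(4,5)
proof (induction k arbitrary: f)
  case 0
  then show ?case using assms(3) by (auto intro: continuous_on_compose2)
next
  case (Suc k)
  let ?f' = "\<lambda>x. frechet_derivative f (at x)" and ?h' = "\<lambda>x. frechet_derivative h (at x)"
  show ?case
  proof (rule Ck_on_SucI[OF assms(1)])
    fix x assume x: "x \<in> S"
    have df: "(f has_derivative ?f' (h x)) (at (h x))"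
      using Ck_on_has_derivative[OF Suc.prems(1)] assms(3) x by blast
    have chain: "((\<lambda>x. f (h x)) has_derivative (\<lambda>v. ?f' (h x) (?h' x v))) (at x)"
      using diff_chain_at[OF Ck_on_has_derivative[OF Suc.prems(2) x] df] by (simp add: o_def)
    \<comment> \<open>In the chain rule the direction \<open>?h' x v\<close> moves with
      \<open>x\<close>, while \<open>Ck_on\<close> controls derivatives in fixed directions only.
      Expanding it in the basis turns the derivative into sums of products of controlled
      functions.\<close>
    have *: "?f' (h x) w = (\<Sum>b\<in>Basis. ?f' (h x) b * inner w b)" for w
    proof -
      have "linear (?f' (h x))" using df by (simp add: has_derivative_linear)
      then have "?f' (h x) (\<Sum>b\<in>Basis. inner w b *\<^sub>R b) = (\<Sum>b\<in>Basis. ?f' (h x) b * inner w b)"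
        by (simp add: linear_sum linear_scale mult.commute)
      then show ?thesis by (simp add: euclidean_representation)
    qed
    show "((\<lambda>x. f (h x)) has_derivative
        (\<lambda>v. \<Sum>b\<in>Basis. ?f' (h x) b * inner (?h' x v) b)) (at x)"
      by (rule has_derivative_eq_rhs[OF chain]) (use * in blast)
  next
    show "Ck_on k S (\<lambda>x. \<Sum>b\<in>Basis. ?f' (h x) b * inner (?h' x v) b)" for v
      using Suc.prems
      by (intro Ck_on_sum Ck_on_mult Suc.IH Ck_on_SucD[OF Suc.prems(2)] assms(1)
          Ck_on_bounded_linear[OF bounded_linear_inner_left]) auto
  qed
qed

section \<open>Parameter integrals and Hadamard's lemma\<close>

text \<open>Differentiating under the integral sign brings out a factor \<open>t\<close> from the
  inner map, so the weight \<open>t ^ j\<close> is what makes the statement inductive; Hadamard's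
  lemma takes \<open>j = 0\<close>.\<close>

lemma Ck_on_integral_segment:
  fixes f :: "'e::euclidean_space \<Rightarrow> real"
  assumes S: "open S" "convex S" and a: "a \<in> S" and "Ck_on k S f"
  shows "Ck_on k S (\<lambda>x. integral {0..1} (\<lambda>t. t ^ j * f (a + t *\<^sub>R (x - a))))"
  using assms(4)
proof (induction k arbitrary: f j)
  have seg: "a + t *\<^sub>R (x - a) \<in> S" if "x \<in> S" "t \<in> {0..1}" for x t
    using convexD_alt[OF S(2) a that(1), of t] that(2) by (simp add: algebra_simps)
  have cont: "continuous_on (S \<times> {0..1}) (\<lambda>(x, t). t ^ j * f (a + t *\<^sub>R (x - a)))"
    if "continuous_on S f" for f :: "'e \<Rightarrow> real" and j
    using seg by (auto simp: split_beta intro!: continuous_intros continuous_on_compose2[OF that])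
  {
    case 0
    show ?case
      using integral_continuous_on_param[of S 0 1 "\<lambda>x t. t ^ j * f (a + t *\<^sub>R (x - a))"] cont[of f j] 0
      by simp
  next
    case (Suc k)
    let ?f' = "\<lambda>x. frechet_derivative f (at x)"
    \<comment> \<open>The Leibniz integral rule wants the derivative as a jointly continuous map
      into bounded linear functions. In finite dimension continuity can be checked on basis vectors,
      which is what \<open>Ck_on\<close> supplies.\<close>
    let ?D = "\<lambda>x t. Blinfun (\<lambda>v. t ^ Suc j * ?f' (a + t *\<^sub>R (x - a)) v)"
    have df: "(f has_derivative ?f' x) (at x)" if "x \<in> S" for x
      using Ck_on_has_derivative[OF Suc.prems that] .
    have bl: "bounded_linear (\<lambda>v. t ^ Suc j * ?f' (a + t *\<^sub>R (x - a)) v)"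
      if "x \<in> S" "t \<in> {0..1}" for x t
      by (rule bounded_linear_const_mult[OF has_derivative_bounded_linear[OF df[OF seg[OF that]]]])
    have Dap: "blinfun_apply (?D x t) v = t ^ Suc j * ?f' (a + t *\<^sub>R (x - a)) v"
      if "x \<in> S" "t \<in> {0..1}" for x t v
      using bounded_linear_Blinfun_apply[OF bl[OF that]] by simp
    have cD: "continuous_on (S \<times> {0..1}) (\<lambda>(x, t). ?D x t)"
      unfolding split_beta
    proof (rule continuous_on_blinfun_componentwise)
      fix i :: 'e
      have "continuous_on S (\<lambda>x. ?f' x i)" using Suc.prems by (intro Ck_on_imp_continuous_on[of k]) simp
      from cont[OF this, of "Suc j"]
      show "continuous_on (S \<times> {0..1}) (\<lambda>x. blinfun_apply (?D (fst x) (snd x)) i)"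
        by (rule continuous_on_cong[THEN iffD1, rotated -1]) (auto simp: Dap split_beta simp del: power_Suc)
    qed
    show ?case
    proof (rule Ck_on_SucI[OF S(1)])
      fix x assume x: "x \<in> S"
      have "((\<lambda>x. integral (cbox 0 1) (\<lambda>t. t ^ j * f (a + t *\<^sub>R (x - a)))) has_derivative
          integral (cbox 0 1) (?D x)) (at x within S)"
      proof (rule leibniz_rule[OF _ _ _ x S(2)])
        fix y t assume y: "y \<in> S" and t: "t \<in> cbox 0 (1::real)"
        have "((\<lambda>x. t ^ j * f (a + t *\<^sub>R (x - a))) has_derivative
            (\<lambda>v. t ^ j * ?f' (a + t *\<^sub>R (y - a)) (t *\<^sub>R v))) (at y within S)"
          by (intro has_derivative_mult_right
              has_derivative_compose[where f = "\<lambda>x. a + t *\<^sub>R (x - a)", OF _ df] seg y)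
            (use t in \<open>auto intro!: derivative_eq_intros\<close>)
        moreover have "?f' (a + t *\<^sub>R (y - a)) (t *\<^sub>R v) = t * ?f' (a + t *\<^sub>R (y - a)) v" for v
          using has_derivative_linear[OF df[OF seg[OF y]], of t] t by (simp add: linear_scale)
        ultimately show "((\<lambda>x. t ^ j * f (a + t *\<^sub>R (x - a))) has_derivative blinfun_apply (?D y t))
            (at y within S)"
          using Dap[OF y, of t] t by (elim has_derivative_eq_rhs) (auto simp: fun_eq_iff)
      next
        fix y assume y: "y \<in> S"
        have "continuous_on {0..1} (\<lambda>t. (case (y, t) of (x, t) \<Rightarrow> t ^ j * f (a + t *\<^sub>R (x - a))))"
          by (rule continuous_on_compose2[OF cont[OF Ck_on_imp_continuous_on[OF Suc.prems], of j]])
            (use y in \<open>auto intro!: continuous_intros\<close>)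
        then show "(\<lambda>t. t ^ j * f (a + t *\<^sub>R (y - a))) integrable_on cbox 0 1"
          by (auto intro: integrable_continuous_real)
      qed (use cD in simp)
      moreover have "blinfun_apply (integral (cbox 0 1) (?D x)) v =
          integral {0..1} (\<lambda>t. t ^ Suc j * ?f' (a + t *\<^sub>R (x - a)) v)" for v
      proof -
        have "continuous_on {0..1} (\<lambda>t. (case (x, t) of (x, t) \<Rightarrow> ?D x t))"
          by (rule continuous_on_compose2[OF cD]) (use x in \<open>auto intro!: continuous_intros\<close>)
        then have "?D x integrable_on cbox 0 1" by (auto intro: integrable_continuous_real)
        then have "blinfun_apply (integral (cbox 0 1) (?D x)) v =
            integral (cbox 0 1) (\<lambda>t. blinfun_apply (?D x t) v)"
          by (rule blinfun_apply_integral)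
        also have "\<dots> = integral {0..1} (\<lambda>t. t ^ Suc j * ?f' (a + t *\<^sub>R (x - a)) v)"
          using Dap[OF x] by (auto intro: integral_cong)
        finally show ?thesis .
      qed
      ultimately show "((\<lambda>x. integral {0..1} (\<lambda>t. t ^ j * f (a + t *\<^sub>R (x - a)))) has_derivative
          (\<lambda>v. integral {0..1} (\<lambda>t. t ^ Suc j * ?f' (a + t *\<^sub>R (x - a)) v))) (at x)"
        unfolding at_within_open[OF x S(1)] cbox_interval by (elim has_derivative_eq_rhs) (auto simp: fun_eq_iff)
    next
      show "Ck_on k S (\<lambda>x. integral {0..1} (\<lambda>t. t ^ Suc j * ?f' (a + t *\<^sub>R (x - a)) v))" for v
        using Suc.prems by (intro Suc.IH) auto
    qed
  }
qed

text \<open>\<open>h b\<close> averages the partial derivative along the segment from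
  \<open>a\<close> to \<open>x\<close>, and the expansion is the fundamental theorem of calculus on
  that segment. At \<open>x = a\<close> the integrand is constant, which gives the value of
  \<open>h b a\<close>.\<close>

lemma hadamard:
  fixes f :: "'e::euclidean_space \<Rightarrow> real"
  assumes S: "open S" "convex S" and a: "a \<in> S" and f: "smooth_on S f"
  obtains h where "\<forall>b. smooth_on S (h b)"
    and "\<forall>x\<in>S. f x = f a + (\<Sum>b\<in>Basis. inner (x - a) b * h b x)"
    and "\<forall>b. h b a = frechet_derivative f (at a) b"
proof
  let ?f' = "\<lambda>x. frechet_derivative f (at x)"
  let ?h = "\<lambda>b x. integral {0..1} (\<lambda>t. t ^ 0 * ?f' (a + t *\<^sub>R (x - a)) b)"
  have Ck: "Ck_on k S f" for k using f by (simp add: smooth_on_def)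
  have df: "(f has_derivative ?f' x) (at x)" if "x \<in> S" for x
    using Ck_on_has_derivative[OF Ck that] .
  have Ck': "Ck_on k S (\<lambda>x. ?f' x b)" for k b using Ck[of "Suc k"] by simp
  show "\<forall>b. smooth_on S (?h b)"
    unfolding smooth_on_def by (intro allI Ck_on_integral_segment S a Ck')
  show "\<forall>b. ?h b a = frechet_derivative f (at a) b" by simp
  show "\<forall>x\<in>S. f x = f a + (\<Sum>b\<in>Basis. inner (x - a) b * ?h b x)"
  proof
    fix x assume x: "x \<in> S"
    have seg: "a + t *\<^sub>R (x - a) \<in> S" if "t \<in> {0..1}" for t
      using convexD_alt[OF S(2) a x, of t] that by (simp add: algebra_simps)
    have "((\<lambda>t. f (a + t *\<^sub>R (x - a))) has_vector_derivative ?f' (a + t *\<^sub>R (x - a)) (x - a))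
        (at t within {0..1})" if "t \<in> {0..1}" for t
    proof -
      have "((\<lambda>t. f (a + t *\<^sub>R (x - a))) has_derivative (\<lambda>s. ?f' (a + t *\<^sub>R (x - a)) (s *\<^sub>R (x - a))))
          (at t within {0..1})"
        by (rule has_derivative_compose[where f = "\<lambda>t. a + t *\<^sub>R (x - a)", OF _ df[OF seg[OF that]]]) (auto intro!: derivative_eq_intros)
      then show ?thesis
        using has_derivative_linear[OF df[OF seg[OF that]]]
        by (simp add: has_vector_derivative_def linear_scale)
    qed
    then have 1: "((\<lambda>t. ?f' (a + t *\<^sub>R (x - a)) (x - a)) has_integral
        f (a + 1 *\<^sub>R (x - a)) - f (a + 0 *\<^sub>R (x - a))) {0..1}"
      by (intro fundamental_theorem_of_calculus) auto
    have 2: "((\<lambda>t. ?f' (a + t *\<^sub>R (x - a)) (x - a)) has_integral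
        (\<Sum>b\<in>Basis. inner (x - a) b * ?h b x)) {0..1}"
    proof -
      have c: "continuous_on {0..1} (\<lambda>t. ?f' (a + t *\<^sub>R (x - a)) b)" for b
        using Ck_on_imp_continuous_on[OF Ck'[of 0 b]]
        by (rule continuous_on_compose2) (use seg in \<open>auto intro!: continuous_intros\<close>)
      have int: "((\<lambda>t. \<Sum>b\<in>Basis. inner (x - a) b * ?f' (a + t *\<^sub>R (x - a)) b) has_integral
          (\<Sum>b\<in>Basis. inner (x - a) b * ?h b x)) {0..1}"
        by (intro has_integral_sum has_integral_mult_right)
          (use c in \<open>auto intro!: integrable_integral integrable_continuous_real\<close>)
      have eq: "?f' (a + t *\<^sub>R (x - a)) (x - a) =
          (\<Sum>b\<in>Basis. inner (x - a) b * ?f' (a + t *\<^sub>R (x - a)) b)" if "t \<in> {0..1}" for t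
      proof -
        have "?f' (a + t *\<^sub>R (x - a)) (\<Sum>b\<in>Basis. inner (x - a) b *\<^sub>R b) =
            (\<Sum>b\<in>Basis. inner (x - a) b * ?f' (a + t *\<^sub>R (x - a)) b)"
          using has_derivative_linear[OF df[OF seg[OF that]]] by (simp add: linear_sum linear_scale)
        then show ?thesis by (simp add: euclidean_representation)
      qed
      show ?thesis
        by (rule has_integral_eq[OF _ int]) (rule eq[symmetric])
    qed
    from has_integral_unique[OF 1 2]
    show "f x = f a + (\<Sum>b\<in>Basis. inner (x - a) b * ?h b x)" by simp
  qed
qed

section \<open>Smooth maps on open sets\<close>

lemma Ck_on_ident: "open S \<Longrightarrow> Ck_on k S (\<lambda>x. x)"
  by (cases k) (auto intro!: Ck_on_SucI[where f' = "\<lambda>x v. v"] Ck_on_const simp del: Ck_on.simps(2))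

lemma smooth_on_cong:
  "open S \<Longrightarrow> (\<And>x. x \<in> S \<Longrightarrow> f x = g x) \<Longrightarrow> smooth_on S f \<Longrightarrow> smooth_on S g"
  unfolding smooth_on_def by (blast intro: Ck_on_cong)

lemma smooth_on_subset: "smooth_on S f \<Longrightarrow> T \<subseteq> S \<Longrightarrow> smooth_on T f"
  unfolding smooth_on_def by (blast intro: Ck_on_subset)

lemma smooth_on_local:
  "(\<And>x. x \<in> S \<Longrightarrow> \<exists>T. open T \<and> x \<in> T \<and> smooth_on T f) \<Longrightarrow> smooth_on S f"
  unfolding smooth_on_def by (intro allI Ck_on_local) meson

lemma smooth_on_has_derivative:
  "smooth_on S f \<Longrightarrow> x \<in> S \<Longrightarrow> (f has_derivative frechet_derivative f (at x)) (at x)"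
  unfolding smooth_on_def by (blast intro: Ck_on_has_derivative)

lemma smooth_on_frechet_derivative:
  assumes "smooth_on S f"
  shows "smooth_on S (\<lambda>x. frechet_derivative f (at x) v)"
proof -
  have "Ck_on (Suc k) S f" for k using assms by (simp add: smooth_on_def)
  then show ?thesis by (simp add: smooth_on_def)
qed

lemma smooth_on_const: "open S \<Longrightarrow> smooth_on S (\<lambda>x. c)"
  by (simp add: smooth_on_def Ck_on_const)

lemma smooth_on_ident: "open S \<Longrightarrow> smooth_on S (\<lambda>x. x)"
  by (simp add: smooth_on_def Ck_on_ident)

lemma smooth_on_bounded_linear:
  "bounded_linear L \<Longrightarrow> open S \<Longrightarrow> smooth_on S f \<Longrightarrow> smooth_on S (\<lambda>x. L (f x))"
  by (simp add: smooth_on_def Ck_on_bounded_linear)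

lemma smooth_on_add:
  "open S \<Longrightarrow> smooth_on S f \<Longrightarrow> smooth_on S g \<Longrightarrow> smooth_on S (\<lambda>x. f x + g x)"
  by (simp add: smooth_on_def Ck_on_add)

lemma smooth_on_sum:
  "open S \<Longrightarrow> (\<And>i. i \<in> I \<Longrightarrow> smooth_on S (f i)) \<Longrightarrow> smooth_on S (\<lambda>x. \<Sum>i\<in>I. f i x)"
  by (simp add: smooth_on_def Ck_on_sum)

lemma smooth_on_mult:
  fixes f g :: "'e::euclidean_space \<Rightarrow> real"
  shows "open S \<Longrightarrow> smooth_on S f \<Longrightarrow> smooth_on S g \<Longrightarrow> smooth_on S (\<lambda>x. f x * g x)"
  by (simp add: smooth_on_def Ck_on_mult)

lemma smooth_on_inverse:
  fixes f :: "'e::euclidean_space \<Rightarrow> real"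
  shows "open S \<Longrightarrow> smooth_on S f \<Longrightarrow> (\<And>x. x \<in> S \<Longrightarrow> f x \<noteq> 0) \<Longrightarrow>
    smooth_on S (\<lambda>x. inverse (f x))"
  by (simp add: smooth_on_def Ck_on_inverse)

lemma smooth_on_compose:
  fixes f :: "'e::euclidean_space \<Rightarrow> real"
  shows "open S \<Longrightarrow> open T \<Longrightarrow> h ` S \<subseteq> T \<Longrightarrow> smooth_on T f \<Longrightarrow> smooth_on S h \<Longrightarrow>
    smooth_on S (\<lambda>x. f (h x))"
  unfolding smooth_on_def by (blast intro: Ck_on_compose)

text \<open>\<open>T\<close> and \<open>- K\<close> are open and cover the space, and
  \<open>f\<close> vanishes on the second. This globalizes a product of a plateau function with a
  locally smooth one.\<close>

lemma smooth_on_extend_zero: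
  assumes "smooth_on T f" "open T" "closed K" "K \<subseteq> T" "\<And>x. x \<notin> K \<Longrightarrow> f x = 0"
  shows "smooth_on UNIV f"
proof (rule smooth_on_local)
  fix x
  have "smooth_on (- K) f"
    by (rule smooth_on_cong[OF _ _ smooth_on_const]) (use assms in \<open>auto simp: open_Compl\<close>)
  then show "\<exists>T. open T \<and> x \<in> T \<and> smooth_on T f"
    using assms by (cases "x \<in> T") (blast, metis ComplI open_Compl subsetD)
qed


section \<open>Bump functions\<close>

text \<open>The powers of \<open>inverse x\<close> make the family closed under differentiation up
  to linear combinations, so smoothness is one induction for all \<open>n\<close> at once. The case
  \<open>n = 0\<close> is the classical flat function.\<close>

definition flat_exp :: "nat \<Rightarrow> real \<Rightarrow> real" where
  "flat_exp n x = (if x > 0 then inverse x ^ n * exp (- inverse x) else 0)"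

lemma flat_exp_pos: "x > 0 \<Longrightarrow> flat_exp n x > 0"
  and flat_exp_0: "x \<le> 0 \<Longrightarrow> flat_exp n x = 0"
  and flat_exp_nonneg: "flat_exp n x \<ge> 0"
  by (auto simp: flat_exp_def)

lemma DERIV_flat_exp:
  "(flat_exp n has_real_derivative flat_exp (n + 2) x - n * flat_exp (n + 1) x) (at x)"
proof -
  consider "x > 0" | "x < 0" | "x = 0" by linarith
  then show ?thesis
  proof cases
    case 1
    let ?i = "inverse x"
    \<comment> \<open>Subtraction is truncated here: for \<open>n = 0\<close> the exponents do not
      match, but the factor \<open>real n\<close> vanishes.\<close>
    have P: "real n * ?i ^ (n - Suc 0) * ?i = real n * ?i ^ n" by (cases n) auto
    have "((\<lambda>x. inverse x ^ n * exp (- inverse x)) has_real_derivative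
        real n * ?i ^ (n - Suc 0) * (- (?i * ?i)) * exp (- ?i) + ?i ^ n * (exp (- ?i) * (?i * ?i))) (at x)"
      using 1 by (auto intro!: derivative_eq_intros)
    also have "real n * ?i ^ (n - Suc 0) * (- (?i * ?i)) * exp (- ?i) + ?i ^ n * (exp (- ?i) * (?i * ?i)) =
        ?i ^ n * (exp (- ?i) * (?i * ?i)) - (real n * ?i ^ (n - Suc 0) * ?i) * ?i * exp (- ?i)"
      by (simp add: algebra_simps)
    also have "\<dots> = flat_exp (n + 2) x - n * flat_exp (n + 1) x"
      unfolding P using 1 by (simp add: flat_exp_def power_add power2_eq_square)
    finally have "((\<lambda>x. inverse x ^ n * exp (- inverse x)) has_real_derivative
        flat_exp (n + 2) x - n * flat_exp (n + 1) x) (at x)" .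
    then show ?thesis
      by (rule has_field_derivative_transform_within_open[where S = "{0<..}"])
        (use 1 in \<open>auto simp: flat_exp_def\<close>)
  next
    case 2
    have "((\<lambda>x. 0) has_real_derivative flat_exp (n + 2) x - n * flat_exp (n + 1) x) (at x)"
      using 2 by (simp add: flat_exp_0)
    then show ?thesis
      by (rule has_field_derivative_transform_within_open[where S = "{..<0}"])
        (use 2 in \<open>auto simp: flat_exp_0\<close>)
  next
    case 3
    \<comment> \<open>At 0 the difference quotient is \<open>flat_exp n h / h\<close>. From the
      right it tends to 0 because the exponential of \<open>inverse h\<close> outgrows its powers;
      from the left it is identically 0.\<close>
    have "((\<lambda>h. inverse h ^ Suc n / exp (inverse h)) \<longlongrightarrow> 0) (at_right (0::real))"
      by (rule filterlim_compose[OF tendsto_power_div_exp_0 filterlim_inverse_at_top_right])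
    then have "((\<lambda>h. flat_exp n h / h) \<longlongrightarrow> 0) (at_right 0)"
    proof (rule Lim_transform_eventually)
      show "\<forall>\<^sub>F h in at_right 0. inverse h ^ Suc n / exp (inverse h) = flat_exp n h / h"
        using eventually_at_right_less[of "0::real"]
        by eventually_elim (simp add: flat_exp_def exp_minus field_simps)
    qed
    moreover have "((\<lambda>h. flat_exp n h / h) \<longlongrightarrow> 0) (at_left 0)"
      by (rule Lim_transform_eventually[OF tendsto_const])
        (simp add: eventually_at_filter flat_exp_0)
    ultimately have "((\<lambda>h. flat_exp n h / h) \<longlongrightarrow> 0) (at 0)"
      by (simp add: filterlim_at_split)
    then show ?thesis
      using 3 by (simp add: DERIV_def flat_exp_0)
  qed
qed

lemma smooth_on_flat_exp: "smooth_on UNIV (flat_exp n)"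
proof -
  have "Ck_on k UNIV (flat_exp n)" for k
  proof (induction k arbitrary: n)
    case 0
    show ?case using DERIV_flat_exp by (auto intro!: continuous_at_imp_continuous_on DERIV_isCont)
  next
    case (Suc k)
    have "((flat_exp n) has_derivative
        (\<lambda>v. (flat_exp (n + 2) x + (- real n) * flat_exp (n + 1) x) * v)) (at x)" for x
      using DERIV_flat_exp[of n x] by (simp add: has_field_derivative_def)
    then show ?case
      by (rule Ck_on_SucI[OF open_UNIV])
        (intro Ck_on_mult Ck_on_add Ck_on_const Suc.IH open_UNIV)
  qed
  then show ?thesis by (simp add: smooth_on_def)
qed

text \<open>The quotient a / (a + b) with a = \<open>flat_exp 0 (2 - s)\<close> and b =
  \<open>flat_exp 0 (s - 1)\<close>, where s is the squared distance from \<open>c\<close> in units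
  of \<open>r\<close>. It is 1 for s \<le> 1, where b vanishes, and 0 for s \<ge> 2, where a
  vanishes; outside \<open>cball c (2 * r)\<close> even s > 4 holds. The denominator is positive
  because s < 2 or s > 1.\<close>

lemma plateau_exists:
  fixes c :: "'e::euclidean_space"
  assumes "r > 0"
  obtains u :: "'e \<Rightarrow> real" where "smooth_on UNIV u"
    and "\<And>x. x \<in> cball c r \<Longrightarrow> u x = 1" and "\<And>x. x \<notin> cball c (2 * r) \<Longrightarrow> u x = 0"
proof
  \<comment> \<open>The squared distance is spelled out in coordinates, using only sums and
    products, so that the closure rules for smooth maps apply to it directly.\<close>
  let ?q = "\<lambda>x. \<Sum>b\<in>Basis. (inverse r * inner (x + - c) b) * (inverse r * inner (x + - c) b)"
  let ?u = "\<lambda>x. flat_exp 0 (2 + (-1) * ?q x) *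
    inverse (flat_exp 0 (2 + (-1) * ?q x) + flat_exp 0 (?q x + -1))"
  have q: "?q x = (dist c x / r)\<^sup>2" for x
  proof -
    have "(dist c x / r)\<^sup>2 = (inverse r)\<^sup>2 * inner (x - c) (x - c)"
      by (simp add: dist_norm norm_minus_commute power_divide dot_square_norm field_simps)
    also have "\<dots> = ?q x"
      by (subst euclidean_inner) (simp add: sum_distrib_left power2_eq_square mult_ac)
    finally show ?thesis by simp
  qed
  have "smooth_on UNIV ?q"
    by (intro smooth_on_sum smooth_on_mult smooth_on_const open_UNIV
        smooth_on_bounded_linear[OF bounded_linear_inner_left] smooth_on_add smooth_on_ident)
  moreover have pos: "flat_exp 0 (2 + (-1) * s) + flat_exp 0 (s + -1) > 0" for s
  proof (cases "s < 2")
    case True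
    then show ?thesis by (intro add_pos_nonneg[OF flat_exp_pos flat_exp_nonneg]) simp
  next
    case False
    then show ?thesis by (intro add_nonneg_pos[OF flat_exp_nonneg flat_exp_pos]) simp
  qed
  ultimately show "smooth_on UNIV ?u"
    by (intro smooth_on_mult smooth_on_inverse smooth_on_add open_UNIV
        smooth_on_compose[OF _ open_UNIV subset_UNIV smooth_on_flat_exp] smooth_on_const)
      (auto simp: less_imp_neq[symmetric])
  show "?u x = 1" if "x \<in> cball c r" for x
  proof -
    have "?q x \<le> 1" unfolding q using that assms by (simp add: power_le_one)
    then have "flat_exp 0 (?q x + -1) = 0" and "flat_exp 0 (2 + (-1) * ?q x) > 0"
      by (auto intro!: flat_exp_0 flat_exp_pos)
    then show ?thesis by simp
  qed
  show "?u x = 0" if "x \<notin> cball c (2 * r)" for x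
  proof -
    have "dist c x / r \<ge> 2" using that assms by (simp add: field_simps)
    then have "(dist c x / r)\<^sup>2 \<ge> 2\<^sup>2" by (rule power_mono) simp
    then have "flat_exp 0 (2 + (-1) * ?q x) = 0" unfolding q by (intro flat_exp_0) simp
    then show ?thesis by simp
  qed
qed

section \<open>Smooth functions and vector fields on a manifold\<close>

definition chart_extension :: "('a, 'e) chart \<Rightarrow> ('e \<Rightarrow> real) \<Rightarrow> 'a \<Rightarrow> real" where
  "chart_extension = (\<lambda>(U, \<phi>) u p. if p \<in> U then u (\<phi> p) else 0)"

locale smooth_manifold =
  fixes A :: "('a::{second_countable_topology, t2_space}, 'e::euclidean_space) chart set"
  assumes atlas: "smooth_atlas A"
begin

lemma chart:
  assumes "(U, \<phi>) \<in> A"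
  shows "open U" "open (\<phi> ` U)" "homeomorphism U (\<phi> ` U) \<phi> (inv_into U \<phi>)" "inj_on \<phi> U"
    and "\<And>p. p \<in> U \<Longrightarrow> inv_into U \<phi> (\<phi> p) = p"
proof -
  have "is_chart (U, \<phi>)" using atlas assms unfolding smooth_atlas_def by blast
  then show "open U" "open (\<phi> ` U)" and h: "homeomorphism U (\<phi> ` U) \<phi> (inv_into U \<phi>)"
    by (simp_all add: is_chart_def)
  show "inj_on \<phi> U" using homeomorphism_apply1[OF h] by (rule inj_on_inverseI)
  then show "\<And>p. p \<in> U \<Longrightarrow> inv_into U \<phi> (\<phi> p) = p" by simp
qed

lemma chart_exists: obtains U \<phi> where "(U, \<phi>) \<in> A" "p \<in> U"
proof -
  have "p \<in> (\<Union>(U, \<phi>)\<in>A. U)" using atlas unfolding smooth_atlas_def by simp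
  then show thesis using that by blast
qed

lemma transition:
  "(U, \<phi>) \<in> A \<Longrightarrow> (V, \<psi>) \<in> A \<Longrightarrow> smooth_on (\<phi> ` (U \<inter> V)) (\<lambda>x. \<psi> (inv_into U \<phi> x))"
  using atlas unfolding smooth_atlas_def comp_def by fast

lemma chart_open_image:
  assumes "(U, \<phi>) \<in> A" "open W"
  shows "open (\<phi> ` (U \<inter> W))"
  using homeomorphism_imp_open_map[OF chart(3)[OF assms(1)], of "U \<inter> W"] chart(2)[OF assms(1)]
  by (metis assms(2) open_openin openin_open openin_open_trans)

lemma chart_open_preimage:
  assumes "(U, \<phi>) \<in> A" "open T"
  shows "open {p \<in> U. \<phi> p \<in> T}"
proof -
  have "open (U \<inter> \<phi> -` T)"
    using continuous_open_preimage[OF homeomorphism_cont1 chart(1)] chart(3) assms by blast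
  then show ?thesis by (simp add: vimage_def Int_def)
qed

lemma smooth_functionsD:
  "f \<in> smooth_functions A \<Longrightarrow> (U, \<phi>) \<in> A \<Longrightarrow> smooth_on (\<phi> ` U) (\<lambda>x. f (inv_into U \<phi> x))"
  unfolding smooth_functions_def comp_def by fast

lemma smooth_functionsI:
  assumes "\<And>U \<phi> p. (U, \<phi>) \<in> A \<Longrightarrow> p \<in> U \<Longrightarrow>
    \<exists>W. open W \<and> p \<in> W \<and> smooth_on (\<phi> ` (U \<inter> W)) (\<lambda>x. f (inv_into U \<phi> x))"
  shows "f \<in> smooth_functions A"
proof -
  have "smooth_on (\<phi> ` U) (\<lambda>x. f (inv_into U \<phi> x))" if c: "(U, \<phi>) \<in> A" for U \<phi>
  proof (rule smooth_on_local)
    fix x assume "x \<in> \<phi> ` U"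
    then obtain p where p: "p \<in> U" "x = \<phi> p" by blast
    with assms[OF c] obtain W where
      "open W" "p \<in> W" "smooth_on (\<phi> ` (U \<inter> W)) (\<lambda>x. f (inv_into U \<phi> x))" by blast
    then show "\<exists>T. open T \<and> x \<in> T \<and> smooth_on T (\<lambda>x. f (inv_into U \<phi> x))"
      using chart_open_image[OF c] p by blast
  qed
  then show ?thesis unfolding smooth_functions_def comp_def by blast
qed

lemma smooth_functions_const: "(\<lambda>p. c) \<in> smooth_functions A"
  and smooth_functions_add:
    "f \<in> smooth_functions A \<Longrightarrow> h \<in> smooth_functions A \<Longrightarrow> (\<lambda>p. f p + h p) \<in> smooth_functions A"
  and smooth_functions_mult:
    "f \<in> smooth_functions A \<Longrightarrow> h \<in> smooth_functions A \<Longrightarrow> (\<lambda>p. f p * h p) \<in> smooth_functions A"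
  by (auto simp: smooth_functions_def comp_def intro!: smooth_on_const smooth_on_add smooth_on_mult
      dest: chart(2))

lemma smooth_functions_sum:
  "(\<And>i. i \<in> I \<Longrightarrow> f i \<in> smooth_functions A) \<Longrightarrow> (\<lambda>p. \<Sum>i\<in>I. f i p) \<in> smooth_functions A"
  by (induction I rule: infinite_finite_induct)
    (auto intro: smooth_functions_const smooth_functions_add)

lemma smooth_functions_prod:
  "(\<And>i. i \<in> I \<Longrightarrow> f i \<in> smooth_functions A) \<Longrightarrow> (\<lambda>p. \<Prod>i\<in>I. f i p) \<in> smooth_functions A"
  by (induction I rule: infinite_finite_induct)
    (auto intro: smooth_functions_const smooth_functions_mult)

lemma smooth_functions_diff:
  assumes "f \<in> smooth_functions A" "h \<in> smooth_functions A"
  shows "(\<lambda>p. f p - h p) \<in> smooth_functions A"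
  using smooth_functions_add[OF assms(1) smooth_functions_mult[OF smooth_functions_const[of "-1"] assms(2)]]
  by simp

text \<open>Tailored to the gluing in the musical isomorphism, where near each point the function is
  a quotient of global smooth functions whose denominator is nonzero on a neighbourhood
  only.\<close>

lemma smooth_functions_local_quotient:
  assumes "\<And>p. \<exists>N u d. open N \<and> p \<in> N \<and> u \<in> smooth_functions A \<and> d \<in> smooth_functions A \<and>
    (\<forall>q\<in>N. d q \<noteq> 0 \<and> f q = u q / d q)"
  shows "f \<in> smooth_functions A"
proof (rule smooth_functionsI)
  fix U \<phi> p assume c: "(U, \<phi>) \<in> A" and p: "p \<in> U"
  obtain N u d where N: "open N" "p \<in> N" and u: "u \<in> smooth_functions A"
    and d: "d \<in> smooth_functions A" and f: "\<forall>q\<in>N. d q \<noteq> 0 \<and> f q = u q / d q"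
    using assms by metis
  let ?i = "inv_into U \<phi>" and ?T = "\<phi> ` (U \<inter> N)"
  have T: "open ?T" by (rule chart_open_image[OF c N(1)])
  have i: "?i x \<in> N" if "x \<in> ?T" for x using that chart(5)[OF c] by auto
  have "smooth_on ?T (\<lambda>x. u (?i x) * inverse (d (?i x)))"
    using f i
    by (intro smooth_on_mult smooth_on_inverse T smooth_on_subset[OF smooth_functionsD[OF u c]]
        smooth_on_subset[OF smooth_functionsD[OF d c]]) auto
  then have "smooth_on ?T (\<lambda>x. f (?i x))"
    by (rule smooth_on_cong[OF T, rotated]) (use f i in \<open>auto simp: field_simps\<close>)
  then show "\<exists>W. open W \<and> p \<in> W \<and> smooth_on (\<phi> ` (U \<inter> W)) (\<lambda>x. f (?i x))"
    using N by blast
qed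

lemma chart_extension_smooth:
  assumes c: "(U, \<phi>) \<in> A" and u: "smooth_on UNIV u"
    and K: "compact K" "K \<subseteq> \<phi> ` U" "\<And>x. x \<notin> K \<Longrightarrow> u x = 0"
  shows "chart_extension (U, \<phi>) u \<in> smooth_functions A"
proof (rule smooth_functionsI)
  fix V \<psi> p assume c': "(V, \<psi>) \<in> A" and p: "p \<in> V"
  let ?i = "inv_into V \<psi>" and ?f = "chart_extension (U, \<phi>) u"
  let ?C = "inv_into U \<phi> ` K"
  have "compact ?C"
    using compact_continuous_image[OF continuous_on_subset[OF homeomorphism_cont2[OF chart(3)[OF c]]]] K
    by blast
  then have C: "open (- ?C)" by (simp add: compact_imp_closed open_Compl)
  show "\<exists>W. open W \<and> p \<in> W \<and> smooth_on (\<psi> ` (V \<inter> W)) (\<lambda>x. ?f (?i x))"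
  proof (cases "p \<in> U")
    case True
    let ?T = "\<psi> ` (V \<inter> U)"
    have T: "open ?T" using chart_open_image[OF c'] chart(1)[OF c] by blast
    have "smooth_on ?T (\<lambda>x. u (\<phi> (?i x)))"
      by (rule smooth_on_compose[OF T open_UNIV subset_UNIV u transition[OF c' c]])
    then have "smooth_on ?T (\<lambda>x. ?f (?i x))"
      by (rule smooth_on_cong[OF T, rotated]) (auto simp: chart_extension_def chart(5)[OF c'])
    then show ?thesis using True chart(1)[OF c] by blast
  next
    case False
    let ?T = "\<psi> ` (V \<inter> - ?C)"
    have T: "open ?T" using chart_open_image[OF c' C] .
    have "?f (?i x) = 0" if "x \<in> ?T" for x
    proof -
      from that obtain q where q: "q \<in> V" "q \<notin> ?C" "?i x = q" using chart(5)[OF c'] by auto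
      have "u (\<phi> q) = 0" if "q \<in> U"
      proof (rule K(3), rule)
        assume "\<phi> q \<in> K"
        then have "inv_into U \<phi> (\<phi> q) \<in> ?C" by blast
        with q(2) that chart(5)[OF c] show False by simp
      qed
      with q show ?thesis by (simp add: chart_extension_def)
    qed
    then have "smooth_on ?T (\<lambda>x. ?f (?i x))"
      by (intro smooth_on_cong[OF T _ smooth_on_const[OF T, of 0]]) auto
    moreover have "p \<notin> ?C" using False K(2) inv_into_into[of _ \<phi> U] by blast
    ultimately show ?thesis using C by blast
  qed
qed

lemma chart_plateau_exists:
  assumes c: "(U, \<phi>) \<in> A" and p: "p \<in> U" and T: "open T" "\<phi> p \<in> T" "T \<subseteq> \<phi> ` U"
  obtains r u where "r > 0" "cball (\<phi> p) (2 * r) \<subseteq> T" "smooth_on UNIV u"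
    "\<forall>x\<in>cball (\<phi> p) r. u x = (1::real)" "\<forall>x. x \<notin> cball (\<phi> p) (2 * r) \<longrightarrow> u x = 0"
    "chart_extension (U, \<phi>) u \<in> smooth_functions A"
proof -
  obtain e where e: "e > 0" "cball (\<phi> p) e \<subseteq> T" using T open_contains_cball by metis
  define r where "r = e / 2"
  have r: "r > 0" "cball (\<phi> p) (2 * r) \<subseteq> T" using e by (auto simp: r_def)
  obtain u where u: "smooth_on UNIV u" "\<And>x. x \<in> cball (\<phi> p) r \<Longrightarrow> u x = (1::real)"
    "\<And>x. x \<notin> cball (\<phi> p) (2 * r) \<Longrightarrow> u x = 0"
    using plateau_exists[OF r(1), of "\<phi> p"] by metis
  then have "chart_extension (U, \<phi>) u \<in> smooth_functions A"
    using r T(3) by (intro chart_extension_smooth[OF c u(1) compact_cball]) auto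
  with r u show thesis using that by blast
qed

lemma bump_exists:
  assumes N: "open N" "p \<in> N"
  obtains \<eta> where "\<eta> \<in> smooth_functions A" "\<eta> p = 1" "\<And>q. q \<notin> N \<Longrightarrow> \<eta> q = 0"
proof -
  obtain U \<phi> where c: "(U, \<phi>) \<in> A" and p: "p \<in> U" by (rule chart_exists)
  have T: "\<phi> p \<in> \<phi> ` (U \<inter> N)" "\<phi> ` (U \<inter> N) \<subseteq> \<phi> ` U" using N(2) p by blast+
  obtain r u where r: "r > 0" "cball (\<phi> p) (2 * r) \<subseteq> \<phi> ` (U \<inter> N)" "smooth_on UNIV u"
    and u: "\<forall>x\<in>cball (\<phi> p) r. u x = (1::real)"
      "\<forall>x. x \<notin> cball (\<phi> p) (2 * r) \<longrightarrow> u x = 0" "chart_extension (U, \<phi>) u \<in> smooth_functions A"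
    by (rule chart_plateau_exists[OF c p chart_open_image[OF c N(1)] T])
  show thesis
  proof
    show "chart_extension (U, \<phi>) u p = 1" using p u(1) r(1) by (simp add: chart_extension_def)
    fix q assume "q \<notin> N"
    then have "\<phi> q \<notin> \<phi> ` (U \<inter> N)" if "q \<in> U" using that chart(4)[OF c] by (auto dest: inj_onD)
    then show "chart_extension (U, \<phi>) u q = 0"
      using u(2) r(2) by (auto simp: chart_extension_def simp del: mem_cball)
  qed (rule u(3))
qed

section \<open>Vector fields as a module of derivations\<close>

lemma vector_fieldsD:
  assumes "X \<in> vector_fields A"
  shows "f \<in> smooth_functions A \<Longrightarrow> X f \<in> smooth_functions A"
    and "f \<notin> smooth_functions A \<Longrightarrow> X f p = 0"
    and "f \<in> smooth_functions A \<Longrightarrow> h \<in> smooth_functions A \<Longrightarrow> X (\<lambda>p. f p + h p) q = X f q + X h q"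
    and "f \<in> smooth_functions A \<Longrightarrow> X (\<lambda>p. c * f p) q = c * X f q"
    and "f \<in> smooth_functions A \<Longrightarrow> h \<in> smooth_functions A \<Longrightarrow>
      X (\<lambda>p. f p * h p) q = f q * X h q + h q * X f q"
  using assms unfolding vector_fields_def plus_fun_def times_fun_def zero_fun_def
  by (auto simp: fun_eq_iff)

lemma vector_fieldsI:
  assumes "\<And>f. f \<in> smooth_functions A \<Longrightarrow> X f \<in> smooth_functions A"
    and "\<And>f p. f \<notin> smooth_functions A \<Longrightarrow> X f p = 0"
    and "\<And>f h q. f \<in> smooth_functions A \<Longrightarrow> h \<in> smooth_functions A \<Longrightarrow>
      X (\<lambda>p. f p + h p) q = X f q + X h q"
    and "\<And>c f q. f \<in> smooth_functions A \<Longrightarrow> X (\<lambda>p. c * f p) q = c * X f q"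
    and "\<And>f h q. f \<in> smooth_functions A \<Longrightarrow> h \<in> smooth_functions A \<Longrightarrow>
      X (\<lambda>p. f p * h p) q = f q * X h q + h q * X f q"
  shows "X \<in> vector_fields A"
  using assms unfolding vector_fields_def plus_fun_def times_fun_def zero_fun_def
  by (auto simp: fun_eq_iff)

lemma vector_fields_zero: "0 \<in> vector_fields A"
  by (rule vector_fieldsI) (auto simp: zero_fun_def intro: smooth_functions_const)

lemma vector_fields_add:
  assumes "X \<in> vector_fields A" "Y \<in> vector_fields A"
  shows "X + Y \<in> vector_fields A"
  by (rule vector_fieldsI)
    (auto simp: plus_fun_def vector_fieldsD[OF assms(1)] vector_fieldsD[OF assms(2)] algebra_simps
      intro!: smooth_functions_add)

lemma vector_fields_fscale:
  assumes "X \<in> vector_fields A" "f \<in> smooth_functions A"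
  shows "f \<odot> X \<in> vector_fields A"
  by (rule vector_fieldsI)
    (auto simp: fscale_def times_fun_def vector_fieldsD[OF assms(1)] algebra_simps
      intro!: smooth_functions_mult assms)

lemma vector_fields_uminus:
  assumes "X \<in> vector_fields A"
  shows "- X \<in> vector_fields A"
proof -
  have "- X = (\<lambda>p. -1) \<odot> X" by (simp add: fscale_def fun_eq_iff)
  then show ?thesis using vector_fields_fscale[OF assms smooth_functions_const] by metis
qed

lemma vector_fields_diff:
  "X \<in> vector_fields A \<Longrightarrow> Y \<in> vector_fields A \<Longrightarrow> X - Y \<in> vector_fields A"
  using vector_fields_add[OF _ vector_fields_uminus] by (metis diff_conv_add_uminus)

lemma vector_fields_sum:
  "(\<And>i. i \<in> I \<Longrightarrow> X i \<in> vector_fields A) \<Longrightarrow> (\<Sum>i\<in>I. X i) \<in> vector_fields A"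
  by (induction I rule: infinite_finite_induct) (auto intro: vector_fields_zero vector_fields_add)

text \<open>The Leibniz rule for 1 = 1 * 1 gives X 1 = 2 X 1; homogeneity then covers every
  constant.\<close>

lemma vector_field_const:
  assumes "X \<in> vector_fields A"
  shows "X (\<lambda>p. c) q = 0"
proof -
  have "X (\<lambda>p. 1) q = 0"
    using vector_fieldsD(5)[OF assms smooth_functions_const smooth_functions_const, of 1 1 q] by simp
  then show ?thesis using vector_fieldsD(4)[OF assms smooth_functions_const, of c 1 q] by simp
qed

lemma vector_field_minus_const:
  assumes "X \<in> vector_fields A" "f \<in> smooth_functions A"
  shows "X (\<lambda>p. f p - c) q = X f q"
  using vector_fieldsD(3)[OF assms smooth_functions_const, of "-c" q]
    vector_field_const[OF assms(1), of "-c" q] by simp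

lemma vector_field_function_sum:
  assumes "X \<in> vector_fields A" "\<And>i. i \<in> I \<Longrightarrow> f i \<in> smooth_functions A"
  shows "X (\<lambda>p. \<Sum>i\<in>I. f i p) q = (\<Sum>i\<in>I. X (f i) q)"
  using assms(2)
proof (induction I rule: infinite_finite_induct)
  case (insert i I)
  then show ?case
    by (simp add: vector_fieldsD(3)[OF assms(1)] smooth_functions_sum)
qed (simp_all add: vector_field_const[OF assms(1)])

end

lemma fun_sum_apply: "(\<Sum>i\<in>I. f i) x = (\<Sum>i\<in>I. f i x)"
  by (induction I rule: infinite_finite_induct) auto

context smooth_manifold
begin

text \<open>On \<open>N\<close>, the \<open>E b\<close> are the coordinate vector fields and the \<open>y b\<close> the coordinate functions of a
  chart, multiplied by a plateau function to be global.\<close>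

lemma local_frame:
  obtains N :: "'a set" and E :: "'e \<Rightarrow> 'a vfield" and y :: "'e \<Rightarrow> 'a \<Rightarrow> real"
  where "open N" "p \<in> N" "\<forall>b. E b \<in> vector_fields A" "\<forall>b. y b \<in> smooth_functions A"
    and "\<forall>X\<in>vector_fields A. \<forall>f\<in>smooth_functions A. \<forall>q\<in>N.
      X f q = (\<Sum>b\<in>Basis. X (y b) q * E b f q)"
    and "\<forall>b\<in>Basis. \<forall>c\<in>Basis. \<forall>q\<in>N. E b (y c) q = (if b = c then 1 else 0)"
proof -
  obtain U \<phi> where c: "(U, \<phi>) \<in> A" and p: "p \<in> U" by (rule chart_exists)
  have pU: "\<phi> p \<in> \<phi> ` U" using p by blast
  obtain r u where r: "r > 0" "cball (\<phi> p) (2 * r) \<subseteq> \<phi> ` U" and u: "smooth_on UNIV u"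
    "\<forall>x\<in>cball (\<phi> p) r. u x = (1::real)" "\<forall>x. x \<notin> cball (\<phi> p) (2 * r) \<longrightarrow> u x = 0"
    "chart_extension (U, \<phi>) u \<in> smooth_functions A"
    by (rule chart_plateau_exists[OF c p chart(2)[OF c] pU subset_refl])
  let ?i = "inv_into U \<phi>" and ?S = "ball (\<phi> p) r"
  have iU: "?i x \<in> U" "\<phi> (?i x) = x" if "x \<in> \<phi> ` U" for x
    using that chart(5)[OF c] by auto
  have SU: "?S \<subseteq> \<phi> ` U" using r by (auto simp: subset_iff)
  define D where "D b f x = frechet_derivative (\<lambda>x. f (?i x)) (at x) b" for b and f :: "'a \<Rightarrow> real" and x
  \<comment> \<open>A function times a derivation is a derivation, so the plateau \<open>u\<close>
    makes the coordinate field global. The second branch is the convention that vector fields vanish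
    on non-smooth functions.\<close>
  define E where "E b f = (if f \<in> smooth_functions A
    then chart_extension (U, \<phi>) (\<lambda>x. u x * D b f x) else (\<lambda>p. 0))" for b f
  define y where "y b = chart_extension (U, \<phi>) (\<lambda>x. u x * inner x b)" for b
  define N where "N = {q \<in> U. \<phi> q \<in> ?S}"
  have cut: "chart_extension (U, \<phi>) (\<lambda>x. u x * w x) \<in> smooth_functions A"
    if w: "smooth_on (\<phi> ` U) w" for w
  proof (rule chart_extension_smooth[OF c _ compact_cball r(2)])
    show "smooth_on UNIV (\<lambda>x. u x * w x)"
      by (rule smooth_on_extend_zero[OF _ chart(2)[OF c] closed_cball r(2)])
        (use u w chart(2)[OF c] in \<open>auto intro!: smooth_on_mult smooth_on_subset[OF u(1)] simp del: mem_cball\<close>)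
  qed (use u(3) in auto)
  have df: "((\<lambda>x. f (?i x)) has_derivative frechet_derivative (\<lambda>x. f (?i x)) (at x)) (at x)"
    if "f \<in> smooth_functions A" "x \<in> \<phi> ` U" for f x
    using smooth_on_has_derivative[OF smooth_functionsD[OF that(1) c] that(2)] .
  have D_eq: "D b f x = f' b" if "((\<lambda>x. f (?i x)) has_derivative f') (at x)" for b f x f'
    unfolding D_def using frechet_derivative_at[OF that] by simp
  have D_add: "D b (\<lambda>p. f p + h p) x = D b f x + D b h x"
    and D_scale: "D b (\<lambda>p. k * f p) x = k * D b f x"
    and D_mult: "D b (\<lambda>p. f p * h p) x = f (?i x) * D b h x + h (?i x) * D b f x"
    if "f \<in> smooth_functions A" "h \<in> smooth_functions A" "x \<in> \<phi> ` U" for b f h x k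
    using D_eq[OF has_derivative_add[OF df[OF that(1,3)] df[OF that(2,3)]], of b]
      D_eq[OF has_derivative_mult_right[OF df[OF that(1,3)], of k], of b]
      D_eq[OF has_derivative_mult[OF df[OF that(1,3)] df[OF that(2,3)]], of b]
    by (simp_all add: D_def)
  have E: "E b \<in> vector_fields A" for b
  proof (rule vector_fieldsI)
    fix f assume "f \<in> smooth_functions A"
    then show "E b f \<in> smooth_functions A"
      using smooth_on_frechet_derivative[OF smooth_functionsD[OF _ c]]
      by (simp add: E_def cut D_def)
  qed (auto simp: E_def chart_extension_def D_add D_scale[OF _ smooth_functions_const] D_mult algebra_simps
      smooth_functions_const smooth_functions_add smooth_functions_mult chart(5)[OF c])
  have y: "y b \<in> smooth_functions A" for b
    unfolding y_def
    by (intro cut smooth_on_bounded_linear[OF bounded_linear_inner_left] smooth_on_ident chart(2)[OF c])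
  have u1: "u x = 1" if "x \<in> ?S" for x using u(2) that by auto
  have yN: "y b q = inner (\<phi> q) b" if "q \<in> N" for b q
    using that u1 by (simp add: y_def N_def chart_extension_def)
  have EN: "E b f q = D b f (\<phi> q)" if "q \<in> N" "f \<in> smooth_functions A" for b f q
    using that u1 by (simp add: E_def N_def chart_extension_def)
  have expand: "X f q = (\<Sum>b\<in>Basis. X (y b) q * E b f q)"
    if X: "X \<in> vector_fields A" and f: "f \<in> smooth_functions A" and q: "q \<in> N" for X f q
  proof -
    have qU: "q \<in> U" "\<phi> q \<in> ?S" using q by (auto simp: N_def)
    obtain h where h: "\<forall>b. smooth_on ?S (h b)"
      "\<forall>x\<in>?S. f (?i x) = f (?i (\<phi> q)) + (\<Sum>b\<in>Basis. inner (x - \<phi> q) b * h b x)"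
      "\<forall>b. h b (\<phi> q) = D b f (\<phi> q)"
      unfolding D_def
      by (rule hadamard[OF open_ball convex_ball qU(2) smooth_on_subset[OF smooth_functionsD[OF f c] SU]])
    \<comment> \<open>The Hadamard coefficients depend on \<open>q\<close> and are smooth only on
      the ball, hence a second plateau, centred at \<open>\<phi> q\<close>.\<close>
    obtain s v where s: "s > 0" "cball (\<phi> q) (2 * s) \<subseteq> ?S" and v: "smooth_on UNIV v"
      "\<forall>x\<in>cball (\<phi> q) s. v x = (1::real)" "\<forall>x. x \<notin> cball (\<phi> q) (2 * s) \<longrightarrow> v x = 0"
      "chart_extension (U, \<phi>) v \<in> smooth_functions A"
      by (rule chart_plateau_exists[OF c qU(1) open_ball qU(2) SU])
    define \<eta> where "\<eta> = chart_extension (U, \<phi>) v"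
    define H where "H b = chart_extension (U, \<phi>) (\<lambda>x. v x * h b x)" for b
    have \<eta>: "\<eta> \<in> smooth_functions A" using v(4) by (simp add: \<eta>_def)
    have H: "H b \<in> smooth_functions A" for b
      unfolding H_def
    proof (rule chart_extension_smooth[OF c _ compact_cball])
      show "smooth_on UNIV (\<lambda>x. v x * h b x)"
        by (rule smooth_on_extend_zero[OF _ open_ball closed_cball s(2)])
          (use v h(1) in \<open>auto intro!: smooth_on_mult smooth_on_subset[OF v(1)] simp del: mem_cball\<close>)
    qed (use v(3) s SU in auto)
    have \<eta>q: "\<eta> q = 1" and Hq: "H b q = E b f q" for b
      using qU(1) v(2) s(1) h(3) EN[OF q f] by (auto simp: \<eta>_def H_def chart_extension_def)
    \<comment> \<open>This is the Hadamard identity multiplied by the square of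
      \<open>\<eta>\<close>: one factor stays with the coordinate difference, the other is absorbed
      in \<open>H b\<close>. Where the cutoff can be nonzero, \<open>z\<close> lies in
      \<open>N\<close>, so \<open>y b\<close> is the true coordinate there; elsewhere both sides are
      0.\<close>
    have id: "(\<eta> z * \<eta> z) * (f z - f q) = (\<Sum>b\<in>Basis. (\<eta> z * (y b z - y b q)) * H b z)" for z
    proof (cases "z \<in> U \<and> \<phi> z \<in> cball (\<phi> q) (2 * s)")
      case True
      then have z: "z \<in> N" "\<phi> z \<in> ?S" using s(2) by (auto simp: N_def)
      have "f z - f q = (\<Sum>b\<in>Basis. inner (\<phi> z - \<phi> q) b * h b (\<phi> z))"
        using bspec[OF h(2) z(2)] True qU by (simp add: chart(5)[OF c])
      then show ?thesis
        using True
        by (simp add: yN[OF z(1)] yN[OF q] \<eta>_def H_def chart_extension_def sum_distrib_left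
            inner_diff_left mult_ac)
    next
      case False
      then have "\<eta> z = 0" using v(3) by (auto simp: \<eta>_def chart_extension_def simp del: mem_cball)
      then show ?thesis by simp
    qed
    have sm: "(\<lambda>z. f z - f q) \<in> smooth_functions A" "(\<lambda>z. y b z - y b q) \<in> smooth_functions A"
      "(\<lambda>z. \<eta> z * \<eta> z) \<in> smooth_functions A"
      "(\<lambda>z. \<eta> z * (y b z - y b q)) \<in> smooth_functions A"
      "(\<lambda>z. (\<eta> z * (y b z - y b q)) * H b z) \<in> smooth_functions A" for b
      by (intro smooth_functions_mult smooth_functions_diff smooth_functions_const f y \<eta> H)+
    \<comment> \<open>Both \<open>f z - f q\<close> and \<open>y b z - y b q\<close> vanish at
      \<open>z = q\<close>. The Leibniz rule therefore never differentiates the cutoff or the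
      coefficients: only \<open>X f\<close> survives on the left and \<open>X (y b)\<close> on the
      right.\<close>
    have "X f q = X (\<lambda>z. (\<eta> z * \<eta> z) * (f z - f q)) q"
      by (simp add: vector_fieldsD(5)[OF X sm(3) sm(1)] vector_field_minus_const[OF X f] \<eta>q)
    also have "\<dots> = (\<Sum>b\<in>Basis. X (\<lambda>z. (\<eta> z * (y b z - y b q)) * H b z) q)"
      unfolding id by (rule vector_field_function_sum[OF X sm(5)])
    also have "\<dots> = (\<Sum>b\<in>Basis. E b f q * X (y b) q)"
      by (simp add: vector_fieldsD(5)[OF X sm(4) H] vector_fieldsD(5)[OF X \<eta> sm(2)]
          vector_field_minus_const[OF X y] \<eta>q Hq)
    also have "\<dots> = (\<Sum>b\<in>Basis. X (y b) q * E b f q)"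
      by (simp only: mult.commute)
    finally show ?thesis .
  qed
  have delta: "E b (y k) q = (if b = k then 1 else 0)" if b: "b \<in> Basis" "k \<in> Basis" and q: "q \<in> N" for b k q
  proof -
    have qS: "\<phi> q \<in> ?S" using q by (auto simp: N_def)
    have "((\<lambda>x. inner x k) has_derivative (\<lambda>v. inner v k)) (at (\<phi> q))"
      by (auto intro!: derivative_eq_intros)
    then have "((\<lambda>x. y k (?i x)) has_derivative (\<lambda>v. inner v k)) (at (\<phi> q))"
    proof (rule has_derivative_transform_within_open[OF _ open_ball qS])
      fix x assume x: "x \<in> ?S"
      have "?i x \<in> N" using iU[of x] SU x by (auto simp: N_def)
      then show "inner x k = y k (?i x)" using yN iU[of x] SU x by auto
    qed
    then show ?thesis using D_eq b by (simp add: EN[OF q y] inner_Basis)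
  qed
  have "open N" "p \<in> N"
    using chart_open_preimage[OF c open_ball] p r(1) by (auto simp: N_def)
  then show thesis using that[of N E y] E y expand delta by simp
qed

end

section \<open>One-forms and the musical isomorphism\<close>

context smooth_manifold
begin

section \<open>Determinants and adjugates with smooth entries\<close>

lemma smooth_functions_det:
  assumes "\<And>i j. i < k \<Longrightarrow> j < k \<Longrightarrow> a i j \<in> smooth_functions A"
  shows "(\<lambda>q. det (mat k k (\<lambda>(i, j). a i j q))) \<in> smooth_functions A"
proof -
  have "det (mat k k (\<lambda>(i, j). a i j q)) =
      (\<Sum>\<pi>\<in>{\<pi>. \<pi> permutes {0..<k}}. signof \<pi> * (\<Prod>i\<in>{0..<k}. a i (\<pi> i) q))" for q
    by (subst det_def'[of _ k]) (auto intro!: sum.cong prod.cong dest: permutes_in_image)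
  moreover have "\<pi> i < k" if "\<pi> permutes {0..<k}" "i < k" for \<pi> i
    using permutes_in_image[OF that(1), of i] that(2) by simp
  ultimately show ?thesis
    using assms
    by (auto intro!: smooth_functions_sum smooth_functions_mult smooth_functions_const smooth_functions_prod)
qed

text \<open>The entries of the adjugate are signed minors, hence polynomials in the
  \<open>G i j\<close>, so they are smooth even where the determinant \<open>d\<close> vanishes. The
  kernel vector in the last clause is what nondegeneracy of the metric will contradict.\<close>

lemma adjugate_exists:
  fixes m :: nat and G :: "nat \<Rightarrow> nat \<Rightarrow> 'a \<Rightarrow> real"
  assumes G: "\<And>i j. i < m \<Longrightarrow> j < m \<Longrightarrow> G i j \<in> smooth_functions A"
  obtains C d where "d \<in> smooth_functions A"
    "\<forall>i<m. \<forall>j<m. C i j \<in> smooth_functions A"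
    "\<forall>q. \<forall>i<m. \<forall>j<m. (\<Sum>k<m. G i k q * C k j q) = (if i = j then d q else 0)"
    "\<forall>q. d q = 0 \<longrightarrow> (\<exists>v. (\<exists>i<m. v i \<noteq> 0) \<and> (\<forall>i<m. (\<Sum>j<m. G i j q * v j) = 0))"
proof
  define M where "M q = mat m m (\<lambda>(i, j). G i j q)" for q
  have M: "M q \<in> carrier_mat m m" for q by (simp add: M_def)
  show "(\<lambda>q. det (M q)) \<in> smooth_functions A"
    unfolding M_def by (rule smooth_functions_det[OF G])
  show "\<forall>i<m. \<forall>j<m. (\<lambda>q. adj_mat (M q) $$ (i, j)) \<in> smooth_functions A"
  proof (intro allI impI)
    fix i j assume ij: "i < m" "j < m"
    \<comment> \<open>\<open>?s j'\<close> enumerates in increasing order the indices other than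
      \<open>j'\<close>, so each minor is again a determinant of entries of
      \<open>G\<close>.\<close>
    let ?s = "\<lambda>j' i'. if i' < j' then i' else Suc i'"
    have del: "mat_delete (M q) j i = mat (m - 1) (m - 1) (\<lambda>(k, l). G (?s j k) (?s i l) q)" for q
      unfolding mat_delete_def M_def using ij by (intro eq_matI) auto
    have adj: "adj_mat (M q) $$ (i, j) = (-1) ^ (j + i) * det (mat_delete (M q) j i)" for q
      using ij M[of q] by (simp add: adj_mat_def cofactor_def)
    show "(\<lambda>q. adj_mat (M q) $$ (i, j)) \<in> smooth_functions A"
      unfolding adj del
      by (intro smooth_functions_mult smooth_functions_const smooth_functions_det G) auto
  qed
  show "\<forall>q. \<forall>i<m. \<forall>j<m. (\<Sum>k<m. G i k q * adj_mat (M q) $$ (k, j)) =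
      (if i = j then det (M q) else 0)"
  proof (intro allI impI)
    fix q i j assume ij: "i < m" "j < m"
    have "(M q * adj_mat (M q)) $$ (i, j) = (\<Sum>k<m. G i k q * adj_mat (M q) $$ (k, j))"
      using ij adj_mat(1)[OF M[of q]]
      by (auto simp: M_def times_mat_def scalar_prod_def lessThan_atLeast0 intro!: sum.cong)
    then show "(\<Sum>k<m. G i k q * adj_mat (M q) $$ (k, j)) = (if i = j then det (M q) else 0)"
      using ij adj_mat(2)[OF M[of q]] by (cases "i = j") auto
  qed
  show "\<forall>q. det (M q) = 0 \<longrightarrow>
      (\<exists>v. (\<exists>i<m. v i \<noteq> 0) \<and> (\<forall>i<m. (\<Sum>j<m. G i j q * v j) = 0))"
  proof (intro allI impI)
    fix q assume "det (M q) = 0"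
    then obtain v where v: "v \<in> carrier_vec m" "v \<noteq> 0\<^sub>v m" "M q *\<^sub>v v = 0\<^sub>v m"
      using det_0_iff_vec_prod_zero_field[OF M[of q]] by blast
    have "\<exists>i<m. v $ i \<noteq> 0"
      using v(1,2) by (metis carrier_vecD eq_vecI index_zero_vec(1) index_zero_vec(2))
    moreover have "(\<Sum>j<m. G i j q * v $ j) = 0" if "i < m" for i
    proof -
      have "(M q *\<^sub>v v) $ i = (\<Sum>j<m. G i j q * v $ j)"
        using that v(1) by (auto simp: M_def scalar_prod_def lessThan_atLeast0 intro!: sum.cong)
      then show ?thesis using v(3) that by simp
    qed
    ultimately show "\<exists>v. (\<exists>i<m. v i \<noteq> 0) \<and> (\<forall>i<m. (\<Sum>j<m. G i j q * v j) = 0)"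
      by blast
  qed
qed

section \<open>One-forms, their locality, and the metric\<close>

definition one_form :: "('a vfield \<Rightarrow> 'a \<Rightarrow> real) \<Rightarrow> bool" where
  "one_form \<omega> \<longleftrightarrow>
     (\<forall>X\<in>vector_fields A. \<omega> X \<in> smooth_functions A) \<and>
     (\<forall>X\<in>vector_fields A. \<forall>Y\<in>vector_fields A. \<omega> (X + Y) = \<omega> X + \<omega> Y) \<and>
     (\<forall>f\<in>smooth_functions A. \<forall>X\<in>vector_fields A. \<omega> (f \<odot> X) = f * \<omega> X)"

lemma one_formD:
  assumes "one_form \<omega>"
  shows "X \<in> vector_fields A \<Longrightarrow> \<omega> X \<in> smooth_functions A"
    and "X \<in> vector_fields A \<Longrightarrow> Y \<in> vector_fields A \<Longrightarrow> \<omega> (X + Y) p = \<omega> X p + \<omega> Y p"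
    and "f \<in> smooth_functions A \<Longrightarrow> X \<in> vector_fields A \<Longrightarrow> \<omega> (f \<odot> X) p = f p * \<omega> X p"
  using assms by (auto simp: one_form_def)

lemma one_form_diff:
  assumes "one_form \<omega>" and X: "X \<in> vector_fields A" and Y: "Y \<in> vector_fields A"
  shows "\<omega> (X - Y) p = \<omega> X p - \<omega> Y p"
  using one_formD(2)[OF assms(1) vector_fields_diff[OF X Y] Y, of p] by simp

lemma one_form_sum:
  assumes \<omega>: "one_form \<omega>"
    and "\<And>i. i \<in> I \<Longrightarrow> f i \<in> smooth_functions A" "\<And>i. i \<in> I \<Longrightarrow> X i \<in> vector_fields A"
  shows "\<omega> (\<Sum>i\<in>I. f i \<odot> X i) p = (\<Sum>i\<in>I. f i p * \<omega> (X i) p)"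
proof -
  have 0: "\<omega> 0 p = 0"
    using one_form_diff[OF \<omega> vector_fields_zero vector_fields_zero, of p] by simp
  show ?thesis
    using assms(2,3)
  proof (induction I rule: infinite_finite_induct)
    case (insert i I)
    then show ?case
      by (simp add: one_formD(2,3)[OF \<omega>] vector_fields_sum vector_fields_fscale del: plus_fun_apply)
  qed (simp_all add: 0 del: zero_fun_apply)
qed

text \<open>For a bump function \<open>\<eta>\<close> at \<open>q\<close> supported in
  \<open>N\<close>, the field \<open>\<eta> \<odot> X\<close> is zero. Linearity over smooth
  functions gives 0 = \<open>\<eta> q * \<omega> X q\<close>, and
  \<open>\<eta> q = 1\<close>.\<close>

lemma one_form_local:
  assumes \<omega>: "one_form \<omega>" and X: "X \<in> vector_fields A" and N: "open N" "q \<in> N"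
    and "\<And>f s. f \<in> smooth_functions A \<Longrightarrow> s \<in> N \<Longrightarrow> X f s = 0"
  shows "\<omega> X q = 0"
proof -
  obtain \<eta> where \<eta>: "\<eta> \<in> smooth_functions A" "\<eta> q = 1" "\<And>s. s \<notin> N \<Longrightarrow> \<eta> s = 0"
    using bump_exists[OF N] by metis
  have "\<eta> s * X f s = 0" for f s
    using assms(5)[of f s] vector_fieldsD(2)[OF X, of f s] \<eta>(3)[of s] by (metis mult_eq_0_iff)
  then have "\<eta> \<odot> X = (\<lambda>p. 0) \<odot> X" by (simp add: fscale_def fun_eq_iff)
  then show ?thesis
    using one_formD(3)[OF \<omega> \<eta>(1) X, of q] one_formD(3)[OF \<omega> smooth_functions_const X, of 0 q] \<eta>(2)
    by simp
qed

lemma metric_one_form: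
  assumes "pseudo_riemannian_metric A g" "X \<in> vector_fields A"
  shows "one_form (g X)" "one_form (\<lambda>Y. g Y X)"
proof -
  show *: "one_form (\<lambda>Y. g Y X)"
    using assms unfolding one_form_def pseudo_riemannian_metric_def by blast
  have "g X Y = g Y X" if "Y \<in> vector_fields A" for Y
    using assms that unfolding pseudo_riemannian_metric_def by blast
  then show "one_form (g X)"
    using * by (simp add: one_form_def vector_fields_add vector_fields_fscale)
qed

lemma metric_commute:
  assumes "pseudo_riemannian_metric A g" "X \<in> vector_fields A" "Y \<in> vector_fields A"
  shows "g X Y = g Y X"
  using assms unfolding pseudo_riemannian_metric_def by blast

lemma metric_nondegenerate:
  assumes "pseudo_riemannian_metric A g" "X \<in> vector_fields A"
    and "\<And>Y. Y \<in> vector_fields A \<Longrightarrow> g X Y p = 0"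
  shows "X f p = 0"
proof (cases "f \<in> smooth_functions A")
  case True
  then show ?thesis using assms unfolding pseudo_riemannian_metric_def by blast
qed (rule vector_fieldsD(2)[OF assms(2)])

lemma metric_cancel:
  assumes g: "pseudo_riemannian_metric A g" and X: "X \<in> vector_fields A" and Y: "Y \<in> vector_fields A"
    and "\<And>Z. Z \<in> vector_fields A \<Longrightarrow> g X Z = g Y Z"
  shows "X = Y"
proof -
  have "(X - Y) f p = 0" for f p
    using assms
    by (intro metric_nondegenerate[OF g vector_fields_diff[OF X Y]])
      (simp add: one_form_diff[OF metric_one_form(2)[OF g] X Y])
  then show ?thesis by (simp add: fun_eq_iff)
qed

text \<open>Cramer's rule in a local frame: the adjugate of the Gram matrix applied to the values of
  \<open>\<omega>\<close> on the frame gives the coefficients of \<open>V\<close>. The result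
  represents \<open>d\<close> times \<open>\<omega>\<close>, so that \<open>V\<close> and
  \<open>d\<close> are both global.\<close>

lemma local_musical:
  assumes g: "pseudo_riemannian_metric A g" and \<omega>: "one_form \<omega>"
  shows "\<exists>N V d. open N \<and> p \<in> N \<and> V \<in> vector_fields A \<and> d \<in> smooth_functions A \<and>
    (\<forall>q\<in>N. d q \<noteq> 0 \<and> (\<forall>Z\<in>vector_fields A. g V Z q = d q * \<omega> Z q))"
proof -
  obtain N :: "'a set" and E0 :: "'e \<Rightarrow> 'a vfield" and y0 :: "'e \<Rightarrow> 'a \<Rightarrow> real"
    where N: "open N" "p \<in> N"
      and E0: "\<forall>b. E0 b \<in> vector_fields A" and y0: "\<forall>b. y0 b \<in> smooth_functions A"
      and frame0: "\<forall>X\<in>vector_fields A. \<forall>f\<in>smooth_functions A. \<forall>q\<in>N.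
        X f q = (\<Sum>b\<in>Basis. X (y0 b) q * E0 b f q)"
      and delta0: "\<forall>b\<in>Basis. \<forall>c\<in>Basis. \<forall>q\<in>N. E0 b (y0 c) q = (if b = c then 1 else 0)"
    by (rule local_frame)
  obtain e where e: "bij_betw e {..<DIM('e)} (Basis :: 'e set)"
    using ex_bij_betw_nat_finite[OF finite_Basis] by (metis lessThan_atLeast0)
  define m where "m = DIM('e)"
  define E y where "E i = E0 (e i)" and "y i = y0 (e i)" for i
  have E: "E i \<in> vector_fields A" and y: "y i \<in> smooth_functions A" for i
    by (simp_all add: E_def y_def E0 y0)
  have frame: "X f q = (\<Sum>i<m. X (y i) q * E i f q)"
    if "X \<in> vector_fields A" "f \<in> smooth_functions A" "q \<in> N" for X f q
    using frame0 that sum.reindex_bij_betw[OF e, of "\<lambda>b. X (y0 b) q * E0 b f q"]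
    unfolding m_def E_def y_def by simp
  have delta: "E i (y j) q = (if i = j then 1 else 0)" if "i < m" "j < m" "q \<in> N" for i j q
  proof -
    have "e i \<in> Basis" "e j \<in> Basis" "e i = e j \<longleftrightarrow> i = j"
      using e that by (auto simp: m_def bij_betw_def inj_on_def)
    then show ?thesis using delta0 that(3) by (simp add: E_def y_def)
  qed
  have expand: "\<theta> X q = (\<Sum>i<m. X (y i) q * \<theta> (E i) q)"
    if \<theta>: "one_form \<theta>" and X: "X \<in> vector_fields A" and q: "q \<in> N" for \<theta> X q
  proof -
    let ?S = "\<Sum>i<m. X (y i) \<odot> E i"
    have Xy: "X (y i) \<in> smooth_functions A" for i by (rule vector_fieldsD(1)[OF X y])
    have S: "?S \<in> vector_fields A" by (intro vector_fields_sum vector_fields_fscale E Xy)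
    \<comment> \<open>\<open>X\<close> and its frame expansion agree as derivations on
      \<open>N\<close>, not globally, so locality is needed before linearity can be used.\<close>
    have "\<theta> (X - ?S) q = 0"
      by (rule one_form_local[OF \<theta> vector_fields_diff[OF X S] N(1) q])
        (simp add: frame[OF X] fun_sum_apply fscale_def)
    then show ?thesis
      by (simp add: one_form_diff[OF \<theta> X S] one_form_sum[OF \<theta> Xy E])
  qed
  let ?G = "\<lambda>i j. g (E i) (E j)"
  have gE: "one_form (\<lambda>X. g X (E i))" for i by (rule metric_one_form(2)[OF g E])
  obtain C d where d: "d \<in> smooth_functions A"
    and C: "\<forall>i<m. \<forall>j<m. C i j \<in> smooth_functions A"
    and adj: "\<forall>q. \<forall>i<m. \<forall>j<m. (\<Sum>k<m. ?G i k q * C k j q) = (if i = j then d q else 0)"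
    and sing: "\<forall>q. d q = 0 \<longrightarrow> (\<exists>v. (\<exists>i<m. v i \<noteq> 0) \<and> (\<forall>i<m. (\<Sum>j<m. ?G i j q * v j) = 0))"
    by (rule adjugate_exists[of m ?G]) (use one_formD(1)[OF gE E] in blast)+
  define x where "x j q = (\<Sum>k<m. C j k q * \<omega> (E k) q)" for j q
  define V where "V = (\<Sum>j<m. x j \<odot> E j)"
  have x: "x j \<in> smooth_functions A" if "j < m" for j
    unfolding x_def using C that one_formD(1)[OF \<omega> E]
    by (auto intro!: smooth_functions_sum smooth_functions_mult)
  have V: "V \<in> vector_fields A"
    unfolding V_def using x by (auto intro!: vector_fields_sum vector_fields_fscale E)
  have VE: "g V (E i) q = d q * \<omega> (E i) q" if "i < m" for i q
  proof -
    have "g V (E i) q = (\<Sum>j<m. x j q * ?G j i q)"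
      unfolding V_def by (rule one_form_sum[OF gE]) (use x E in auto)
    also have "\<dots> = (\<Sum>j<m. \<Sum>k<m. ?G i j q * C j k q * \<omega> (E k) q)"
      by (simp add: x_def sum_distrib_left sum_distrib_right mult_ac metric_commute[OF g E E, of _ i])
    also have "\<dots> = (\<Sum>k<m. (\<Sum>j<m. ?G i j q * C j k q) * \<omega> (E k) q)"
      by (subst sum.swap) (simp add: sum_distrib_right)
    also have "\<dots> = (\<Sum>k<m. (if i = k then d q else 0) * \<omega> (E k) q)"
      using adj that by (intro sum.cong) auto
    also have "\<dots> = d q * \<omega> (E i) q"
      using that by (simp add: if_distrib[of "\<lambda>c. c * _"] cong: if_cong)
    finally show ?thesis .
  qed
  \<comment> \<open>A kernel vector \<open>v\<close> of the Gram matrix at \<open>q\<close>, used as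
    constant coefficients, gives a global field orthogonal at \<open>q\<close> to the frame and
    hence to every field. By nondegeneracy it is zero at \<open>q\<close>, and applying it to
    \<open>y i\<close> recovers \<open>v i = 0\<close>.\<close>
  have "d q \<noteq> 0" if q: "q \<in> N" for q
  proof
    assume "d q = 0"
    then obtain v i where v: "i < m" "v i \<noteq> 0" "\<forall>i<m. (\<Sum>j<m. ?G i j q * v j) = 0"
      using sing by blast
    let ?X = "\<Sum>j<m. (\<lambda>p. v j) \<odot> E j"
    have X: "?X \<in> vector_fields A"
      by (intro vector_fields_sum vector_fields_fscale E smooth_functions_const)
    have "g ?X (E i) q = 0" if "i < m" for i
      using v(3) that
      by (simp add: one_form_sum[OF gE smooth_functions_const E] mult.commute metric_commute[OF g E E, of _ i])
    then have "g ?X Z q = 0" if "Z \<in> vector_fields A" for Z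
      using expand[OF metric_one_form(1)[OF g X] that q] by simp
    then have "?X (y i) q = 0" by (rule metric_nondegenerate[OF g X])
    then have "(\<Sum>j<m. v j * E j (y i) q) = 0" by (simp add: fun_sum_apply fscale_def)
    moreover have "(\<Sum>j<m. v j * E j (y i) q) = (\<Sum>j<m. if j = i then v j else 0)"
      using v(1) by (intro sum.cong) (auto simp: delta[OF _ v(1) q])
    ultimately show False using v(1,2) by simp
  qed
  moreover have "g V Z q = d q * \<omega> Z q" if Z: "Z \<in> vector_fields A" and q: "q \<in> N" for Z q
    by (simp add: expand[OF metric_one_form(1)[OF g V] Z q] expand[OF \<omega> Z q] VE sum_distrib_left mult_ac)
  ultimately show ?thesis using N V d by blast
qed

text \<open>The local representatives \<open>V / d\<close> are glued without a partition of unity: by nondegeneracy they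
  agree wherever two of them are defined.\<close>

lemma musical_isomorphism:
  assumes g: "pseudo_riemannian_metric A g" and \<omega>: "one_form \<omega>"
  obtains W where "W \<in> vector_fields A" "\<And>Z. Z \<in> vector_fields A \<Longrightarrow> g W Z = \<omega> Z"
proof -
  obtain N V d where loc: "\<And>p. open (N p) \<and> p \<in> N p \<and> V p \<in> vector_fields A \<and>
    d p \<in> smooth_functions A \<and>
    (\<forall>q\<in>N p. d p q \<noteq> 0 \<and> (\<forall>Z\<in>vector_fields A. g (V p) Z q = d p q * \<omega> Z q))"
    using local_musical[OF assms] by metis
  have N: "open (N p)" "p \<in> N p" and V: "V p \<in> vector_fields A" and d: "d p \<in> smooth_functions A"
    and d0: "q \<in> N p \<Longrightarrow> d p q \<noteq> 0"
    and gV: "q \<in> N p \<Longrightarrow> Z \<in> vector_fields A \<Longrightarrow> g (V p) Z q = d p q * \<omega> Z q" for p q Z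
    using loc[of p] by blast+
  \<comment> \<open>At each point the representative belonging to that very point is used;
    \<open>W_eq\<close> then shows that any other representative defined there gives the same
    value.\<close>
  define W where "W f q = V q f q / d q q" for f q
  have W_eq: "W f q = V p f q / d p q" if q: "q \<in> N p" for f p q
  proof -
    \<comment> \<open>The two representatives are cross-multiplied by their determinants frozen at
      \<open>q\<close>. Both products represent \<open>d p q * d q q\<close> times
      \<open>\<omega>\<close> at \<open>q\<close>, so nondegeneracy at that one point
      applies.\<close>
    let ?X = "(\<lambda>s. d p q) \<odot> V q - (\<lambda>s. d q q) \<odot> V p"
    have X1: "(\<lambda>s. d p q) \<odot> V q \<in> vector_fields A" and X2: "(\<lambda>s. d q q) \<odot> V p \<in> vector_fields A"
      by (intro vector_fields_fscale V smooth_functions_const)+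
    have "?X f q = 0"
    proof (rule metric_nondegenerate[OF g vector_fields_diff[OF X1 X2]])
      fix Z assume Z: "Z \<in> vector_fields A"
      note gZ = metric_one_form(2)[OF g Z]
      show "g ?X Z q = 0"
        by (simp add: one_form_diff[OF gZ X1 X2] one_formD(3)[OF gZ smooth_functions_const V]
            gV[OF q Z] gV[OF N(2) Z])
    qed
    then have "d p q * V q f q = d q q * V p f q" by (simp add: fscale_def)
    then show ?thesis using d0[OF q] d0[OF N(2)] by (simp add: W_def field_simps)
  qed
  have W: "W \<in> vector_fields A"
  proof (rule vector_fieldsI)
    fix f assume f: "f \<in> smooth_functions A"
    show "W f \<in> smooth_functions A"
    proof (rule smooth_functions_local_quotient)
      fix p
      show "\<exists>N u d. open N \<and> p \<in> N \<and> u \<in> smooth_functions A \<and> d \<in> smooth_functions A \<and>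
          (\<forall>q\<in>N. d q \<noteq> 0 \<and> W f q = u q / d q)"
      proof (intro exI conjI ballI)
        show "W f q = V p f q / d p q" "d p q \<noteq> 0" if "q \<in> N p" for q
          using W_eq[OF that] d0[OF that] .
      qed (use N d vector_fieldsD(1)[OF V f] in auto)
    qed
  qed (simp_all add: W_def vector_fieldsD[OF V] add_divide_distrib)
  have "g W Z q = \<omega> Z q" if Z: "Z \<in> vector_fields A" for Z q
  proof -
    note gZ = metric_one_form(2)[OF g Z]
    note dW = vector_fields_fscale[OF W d]
    \<comment> \<open>The fields \<open>d q \<odot> W\<close> and \<open>V q\<close> agree on
      \<open>N q\<close>, where \<open>W_eq\<close> applies; locality carries this over to the value
      of the metric at \<open>q\<close>.\<close>
    have "g (d q \<odot> W - V q) Z q = 0"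
    proof (rule one_form_local[OF gZ vector_fields_diff[OF dW V] N])
      fix f s assume "s \<in> N q"
      then show "(d q \<odot> W - V q) f s = 0" using d0 by (simp add: fscale_def W_eq)
    qed
    then have "d q q * g W Z q = d q q * \<omega> Z q"
      by (simp add: one_form_diff[OF gZ dW V] one_formD(3)[OF gZ d W] gV[OF N(2) Z])
    then show ?thesis using d0[OF N(2)] by simp
  qed
  then show thesis using that[OF W] by (simp add: fun_eq_iff)
qed

end

section \<open>The family of almost complex connections\<close>

lemma fscale_add_right: "f \<odot> (X + Y) = f \<odot> X + f \<odot> Y"
  and fscale_diff_right: "f \<odot> (X - Y) = f \<odot> X - f \<odot> Y"
  by (simp_all add: fscale_def fun_eq_iff algebra_simps)

context smooth_manifold
begin

lemma one_form_add: "one_form \<omega> \<Longrightarrow> one_form \<theta> \<Longrightarrow> one_form (\<lambda>X p. \<omega> X p + \<theta> X p)"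
  by (simp add: one_form_def fun_eq_iff algebra_simps smooth_functions_add)

lemma one_form_cmult: "one_form \<omega> \<Longrightarrow> one_form (\<lambda>X p. c * \<omega> X p)"
  by (simp add: one_form_def fun_eq_iff algebra_simps smooth_functions_mult smooth_functions_const)

lemma one_form_minus: "one_form \<omega> \<Longrightarrow> one_form \<theta> \<Longrightarrow> one_form (\<lambda>X p. \<omega> X p - \<theta> X p)"
  by (simp add: one_form_def fun_eq_iff algebra_simps smooth_functions_diff)

lemma one_form_uminus: "one_form \<omega> \<Longrightarrow> X \<in> vector_fields A \<Longrightarrow> \<omega> (- X) p = - \<omega> X p"
  using one_form_diff[of \<omega> 0 X p] one_form_diff[of \<omega> 0 0 p] by (simp add: vector_fields_zero)

end

locale norden_manifold = smooth_manifold A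
  for A :: "('a::{second_countable_topology, t2_space}, 'e::euclidean_space) chart set" +
  fixes J :: "'a vfield \<Rightarrow> 'a vfield"
    and g :: "'a vfield \<Rightarrow> 'a vfield \<Rightarrow> 'a \<Rightarrow> real"
    and nabla :: "'a vfield \<Rightarrow> 'a vfield \<Rightarrow> 'a vfield"
  assumes J: "almost_complex_structure A J"
    and g: "pseudo_riemannian_metric A g"
    and norden: "\<forall>X\<in>vector_fields A. \<forall>Y\<in>vector_fields A. g (J X) (J Y) = - g X Y"
    and nabla: "levi_civita_connection A g nabla"
begin

abbreviation "F \<equiv> fundamental_tensor g J nabla"

lemma J_closed: "X \<in> vector_fields A \<Longrightarrow> J X \<in> vector_fields A"
  and J_add: "X \<in> vector_fields A \<Longrightarrow> Y \<in> vector_fields A \<Longrightarrow> J (X + Y) = J X + J Y"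
  and J_fscale: "f \<in> smooth_functions A \<Longrightarrow> X \<in> vector_fields A \<Longrightarrow> J (f \<odot> X) = f \<odot> J X"
  and J_J: "X \<in> vector_fields A \<Longrightarrow> J (J X) = - X"
  using J unfolding almost_complex_structure_def by blast+

lemma J_diff:
  assumes "X \<in> vector_fields A" "Y \<in> vector_fields A"
  shows "J (X - Y) = J X - J Y"
  using J_add[OF vector_fields_diff[OF assms] assms(2)] by simp

lemma nabla_connection: "linear_connection A nabla"
  using nabla unfolding levi_civita_connection_def by blast

lemma nabla_closed: "X \<in> vector_fields A \<Longrightarrow> Y \<in> vector_fields A \<Longrightarrow> nabla X Y \<in> vector_fields A"
  and nabla_add_left: "X \<in> vector_fields A \<Longrightarrow> X' \<in> vector_fields A \<Longrightarrow> Y \<in> vector_fields A \<Longrightarrow>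
    nabla (X + X') Y = nabla X Y + nabla X' Y"
  and nabla_fscale_left: "f \<in> smooth_functions A \<Longrightarrow> X \<in> vector_fields A \<Longrightarrow> Y \<in> vector_fields A \<Longrightarrow>
    nabla (f \<odot> X) Y = f \<odot> nabla X Y"
  and nabla_add_right: "X \<in> vector_fields A \<Longrightarrow> Y \<in> vector_fields A \<Longrightarrow> Y' \<in> vector_fields A \<Longrightarrow>
    nabla X (Y + Y') = nabla X Y + nabla X Y'"
  and nabla_fscale_right: "f \<in> smooth_functions A \<Longrightarrow> X \<in> vector_fields A \<Longrightarrow> Y \<in> vector_fields A \<Longrightarrow>
    nabla X (f \<odot> Y) = X f \<odot> Y + f \<odot> nabla X Y"
  using nabla_connection unfolding linear_connection_def by blast+

lemma nabla_uminus_right: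
  assumes "X \<in> vector_fields A" "Y \<in> vector_fields A"
  shows "nabla X (- Y) = - nabla X Y"
proof -
  have "nabla X 0 = 0"
    using nabla_add_right[OF assms(1) vector_fields_zero vector_fields_zero] by simp
  then show ?thesis
    using nabla_add_right[OF assms vector_fields_uminus[OF assms(2)]] by (simp add: minus_unique)
qed

lemma nabla_metric:
  assumes "X \<in> vector_fields A" "Y \<in> vector_fields A" "Z \<in> vector_fields A"
  shows "X (g Y Z) p = g (nabla X Y) Z p + g Y (nabla X Z) p"
  using nabla assms unfolding levi_civita_connection_def by simp

section \<open>Symmetries and tensoriality of the tensor \<open>F\<close>\<close>

text \<open>Replacing Y by JY in the Norden condition makes J self-adjoint, in contrast to the
  skew-adjoint J of a Hermitian metric. This is the source of the symmetry of
  \<open>F\<close>.\<close>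

lemma g_J:
  assumes X: "X \<in> vector_fields A" and Y: "Y \<in> vector_fields A"
  shows "g (J X) Y = g X (J Y)"
proof
  fix p
  have "g (J X) (J (J Y)) p = - g X (J Y) p" using norden X J_closed[OF Y] by simp
  then show "g (J X) Y p = g X (J Y) p"
    by (simp add: J_J[OF Y] one_form_uminus[OF metric_one_form(1)[OF g J_closed[OF X]] Y])
qed

lemma cov_deriv_J_closed:
  "X \<in> vector_fields A \<Longrightarrow> Y \<in> vector_fields A \<Longrightarrow> cov_deriv_endo nabla J X Y \<in> vector_fields A"
  unfolding cov_deriv_endo_def by (intro vector_fields_diff nabla_closed J_closed)

lemma F_one_form_3: "X \<in> vector_fields A \<Longrightarrow> Y \<in> vector_fields A \<Longrightarrow> one_form (\<lambda>Z. F X Y Z)"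
  unfolding fundamental_tensor_def by (intro metric_one_form(1)[OF g] cov_deriv_J_closed)

text \<open>The covariant derivative of a self-adjoint endomorphism by a metric connection is
  self-adjoint: once \<open>nabla_metric\<close> has removed the derivative of JY, the expression is
  unchanged by swapping Y and Z.\<close>

lemma F_symmetric:
  assumes X: "X \<in> vector_fields A" and Y: "Y \<in> vector_fields A" and Z: "Z \<in> vector_fields A"
  shows "F X Y Z p = F X Z Y p"
proof -
  have F: "F X Y Z p = X (g (J Y) Z) p - g (J Y) (nabla X Z) p - g (nabla X Y) (J Z) p"
    if Y: "Y \<in> vector_fields A" and Z: "Z \<in> vector_fields A" for Y Z
    unfolding fundamental_tensor_def cov_deriv_endo_def
      one_form_diff[OF metric_one_form(2)[OF g Z] nabla_closed[OF X J_closed[OF Y]] J_closed[OF nabla_closed[OF X Y]]]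
    by (simp add: nabla_metric[OF X J_closed[OF Y] Z] g_J[OF nabla_closed[OF X Y] Z])
  show ?thesis
    using g_J[OF Y Z] metric_commute[OF g Y J_closed[OF Z]]
      metric_commute[OF g J_closed[OF Y] nabla_closed[OF X Z]]
      metric_commute[OF g nabla_closed[OF X Y] J_closed[OF Z]]
    by (simp add: F[OF Y Z] F[OF Z Y])
qed

text \<open>Linearity in the second argument is carried over from the third by symmetry, which
  spares cancelling the Leibniz terms of \<open>nabla\<close>.\<close>

lemma F_one_form_2:
  assumes "X \<in> vector_fields A" "Z \<in> vector_fields A"
  shows "one_form (\<lambda>Y. F X Y Z)"
proof -
  have "F X Y Z = F X Z Y" if "Y \<in> vector_fields A" for Y
    using F_symmetric[OF assms(1) that assms(2)] by blast
  then show ?thesis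
    using F_one_form_3[OF assms] by (simp add: one_form_def vector_fields_add vector_fields_fscale)
qed

lemma F_one_form_1:
  assumes Y: "Y \<in> vector_fields A" and Z: "Z \<in> vector_fields A"
  shows "one_form (\<lambda>X. F X Y Z)"
proof -
  let ?N = "\<lambda>X. cov_deriv_endo nabla J X Y"
  have "?N (X + X') = ?N X + ?N X'" if "X \<in> vector_fields A" "X' \<in> vector_fields A" for X X'
    using that Y by (simp add: cov_deriv_endo_def nabla_add_left J_closed J_add nabla_closed)
  moreover have "?N (f \<odot> X) = f \<odot> ?N X" if "f \<in> smooth_functions A" "X \<in> vector_fields A" for f X
    using that Y
    by (simp add: cov_deriv_endo_def nabla_fscale_left J_closed J_fscale nabla_closed fscale_diff_right)
  ultimately show ?thesis
    using metric_one_form(2)[OF g Z] Y cov_deriv_J_closed unfolding one_form_def fundamental_tensor_def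
    by simp
qed

text \<open>Differentiating J J = -1 shows that the covariant derivative of J anticommutes with J;
  self-adjointness of J then moves J across the metric.\<close>

lemma F_J:
  assumes X: "X \<in> vector_fields A" and Y: "Y \<in> vector_fields A" and Z: "Z \<in> vector_fields A"
  shows "F X Y (J Z) p = - F X (J Y) Z p"
proof -
  let ?N = "cov_deriv_endo nabla J X Y"
  have "cov_deriv_endo nabla J X (J Y) = - J ?N"
    unfolding cov_deriv_endo_def
    by (simp add: J_J J_diff J_closed nabla_closed nabla_uminus_right X Y)
  then show ?thesis
    using one_form_uminus[OF metric_one_form(2)[OF g Z] J_closed[OF cov_deriv_J_closed[OF X Y]]]
    by (simp add: fundamental_tensor_def g_J[OF cov_deriv_J_closed[OF X Y] Z])
qed

lemma one_form_J: "one_form \<omega> \<Longrightarrow> one_form (\<lambda>X. \<omega> (J X))"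
  unfolding one_form_def by (simp add: J_closed J_add J_fscale)

lemmas F_uminus =
  one_form_uminus[OF F_one_form_1] one_form_uminus[OF F_one_form_2] one_form_uminus[OF F_one_form_3]

section \<open>The difference tensor and the resulting connections\<close>

definition S :: "real \<Rightarrow> real \<Rightarrow> real \<Rightarrow> real \<Rightarrow> 'a vfield \<Rightarrow> 'a vfield \<Rightarrow> 'a vfield \<Rightarrow> 'a \<Rightarrow> real" where
  "S t1 t2 t3 t4 X Y Z = (\<lambda>p. 1/2 * F X (J Y) Z p
     + t1 * (F Y X Z p + F (J Y) (J X) Z p)
     + t2 * (F Y (J X) Z p - F (J Y) X Z p)
     + t3 * (F Z X Y p + F (J Z) (J X) Y p)
     + t4 * (F Z (J X) Y p - F (J Z) X Y p))"

lemmas F_one_forms =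
  F_one_form_1 F_one_form_2 F_one_form_3
  one_form_J[OF F_one_form_1] one_form_J[OF F_one_form_2] one_form_J[OF F_one_form_3]

lemma S_one_form:
  assumes "X \<in> vector_fields A" "Y \<in> vector_fields A"
  shows "one_form (\<lambda>Z. S t1 t2 t3 t4 X Y Z)" "one_form (\<lambda>Z. S t1 t2 t3 t4 Z X Y)"
    "one_form (\<lambda>Z. S t1 t2 t3 t4 X Z Y)"
  unfolding S_def
  by (intro one_form_add one_form_minus one_form_cmult F_one_forms J_closed assms)+

definition W :: "real \<Rightarrow> real \<Rightarrow> real \<Rightarrow> real \<Rightarrow> 'a vfield \<Rightarrow> 'a vfield \<Rightarrow> 'a vfield" where
  "W t1 t2 t3 t4 X Y =
     (SOME V. V \<in> vector_fields A \<and> (\<forall>Z\<in>vector_fields A. g V Z = S t1 t2 t3 t4 X Y Z))"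

lemma W:
  assumes "X \<in> vector_fields A" "Y \<in> vector_fields A"
  shows "W t1 t2 t3 t4 X Y \<in> vector_fields A"
    and "Z \<in> vector_fields A \<Longrightarrow> g (W t1 t2 t3 t4 X Y) Z = S t1 t2 t3 t4 X Y Z"
proof -
  have "\<exists>V. V \<in> vector_fields A \<and> (\<forall>Z\<in>vector_fields A. g V Z = S t1 t2 t3 t4 X Y Z)"
    using musical_isomorphism[OF g S_one_form(1)[OF assms]] by metis
  from someI_ex[OF this] show "W t1 t2 t3 t4 X Y \<in> vector_fields A"
    and "Z \<in> vector_fields A \<Longrightarrow> g (W t1 t2 t3 t4 X Y) Z = S t1 t2 t3 t4 X Y Z"
    unfolding W_def by blast+
qed

lemma W_unique:
  assumes "X \<in> vector_fields A" "Y \<in> vector_fields A" "V \<in> vector_fields A"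
    and "\<And>Z p. Z \<in> vector_fields A \<Longrightarrow> g V Z p = S t1 t2 t3 t4 X Y Z p"
  shows "V = W t1 t2 t3 t4 X Y"
  using assms(3) W(1)[OF assms(1,2)]
  by (rule metric_cancel[OF g]) (simp add: fun_eq_iff assms(4) W(2)[OF assms(1,2)])

text \<open>\<open>W\<close> is a chosen vector field without a formula, so its linearity comes from
  uniqueness: both sides are metric duals of the same one-form, because \<open>S\<close> is linear
  over smooth functions in X and in Y.\<close>

lemma W_tensor:
  assumes X: "X \<in> vector_fields A" and Y: "Y \<in> vector_fields A"
  shows "X' \<in> vector_fields A \<Longrightarrow> W t1 t2 t3 t4 (X + X') Y = W t1 t2 t3 t4 X Y + W t1 t2 t3 t4 X' Y"
    and "f \<in> smooth_functions A \<Longrightarrow> W t1 t2 t3 t4 (f \<odot> X) Y = f \<odot> W t1 t2 t3 t4 X Y"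
    and "Y' \<in> vector_fields A \<Longrightarrow> W t1 t2 t3 t4 X (Y + Y') = W t1 t2 t3 t4 X Y + W t1 t2 t3 t4 X Y'"
    and "f \<in> smooth_functions A \<Longrightarrow> W t1 t2 t3 t4 X (f \<odot> Y) = f \<odot> W t1 t2 t3 t4 X Y"
proof -
  note metric = metric_one_form(2)[OF g]
  show "W t1 t2 t3 t4 (X + X') Y = W t1 t2 t3 t4 X Y + W t1 t2 t3 t4 X' Y"
    if X': "X' \<in> vector_fields A"
    by (rule W_unique[symmetric])
      (simp_all add: vector_fields_add X Y X' W one_formD(2)[OF metric] one_formD(2)[OF S_one_form(2)]
        del: plus_fun_apply)
  show "W t1 t2 t3 t4 X (Y + Y') = W t1 t2 t3 t4 X Y + W t1 t2 t3 t4 X Y'"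
    if Y': "Y' \<in> vector_fields A"
    by (rule W_unique[symmetric])
      (simp_all add: vector_fields_add X Y Y' W one_formD(2)[OF metric] one_formD(2)[OF S_one_form(3)]
        del: plus_fun_apply)
  show "W t1 t2 t3 t4 (f \<odot> X) Y = f \<odot> W t1 t2 t3 t4 X Y"
    and "W t1 t2 t3 t4 X (f \<odot> Y) = f \<odot> W t1 t2 t3 t4 X Y" if f: "f \<in> smooth_functions A"
    by (rule W_unique[symmetric];
        simp add: vector_fields_fscale X Y f W one_formD(3)[OF metric]
          one_formD(3)[OF S_one_form(2)] one_formD(3)[OF S_one_form(3)])+
qed

definition D :: "real \<Rightarrow> real \<Rightarrow> real \<Rightarrow> real \<Rightarrow> 'a vfield \<Rightarrow> 'a vfield \<Rightarrow> 'a vfield" where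
  "D t1 t2 t3 t4 X Y = nabla X Y + W t1 t2 t3 t4 X Y"

lemma D_linear_connection: "linear_connection A (D t1 t2 t3 t4)"
  unfolding linear_connection_def D_def
  by (simp add: vector_fields_add nabla_closed W(1) nabla_add_left nabla_add_right nabla_fscale_left
      nabla_fscale_right W_tensor fscale_add_right add_ac)

lemma D_family_equation: "family_equation A g J nabla t1 t2 t3 t4 (D t1 t2 t3 t4)"
  unfolding family_equation_def Let_def D_def by (simp add: W(2) S_def)

text \<open>By nondegeneracy the defining equation determines the difference from
  \<open>nabla\<close>. Hence what is proved about the constructed \<open>D\<close> applies to any
  \<open>D'\<close> that satisfies the equation.\<close>

lemma D_unique:
  assumes "\<forall>X\<in>vector_fields A. \<forall>Y\<in>vector_fields A. D' X Y \<in> vector_fields A"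
    and "family_equation A g J nabla t1 t2 t3 t4 D'"
    and X: "X \<in> vector_fields A" and Y: "Y \<in> vector_fields A"
  shows "D' X Y = D t1 t2 t3 t4 X Y"
proof -
  have "D' X Y - nabla X Y = W t1 t2 t3 t4 X Y"
    using assms
    by (intro W_unique vector_fields_diff nabla_closed) (simp_all add: family_equation_def Let_def S_def)
  then show ?thesis by (simp add: D_def algebra_simps)
qed

text \<open>Each bracket takes the same value under Z -> JZ as under Y -> JY, so the parameters drop
  out. The leading term becomes 1/2 F(X,Y,Z) under the first substitution and -1/2 F(X,Y,Z) under
  the second.\<close>

lemma S_J:
  assumes "X \<in> vector_fields A" "Y \<in> vector_fields A" "Z \<in> vector_fields A"
  shows "S t1 t2 t3 t4 X Y (J Z) p - S t1 t2 t3 t4 X (J Y) Z p = F X Y Z p"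
  using assms by (simp add: S_def F_J F_uminus J_J J_closed vector_fields_uminus algebra_simps)

lemma D_almost_complex: "almost_complex_connection A J (D t1 t2 t3 t4)"
  unfolding almost_complex_connection_def
proof (intro conjI ballI D_linear_connection)
  fix X Y assume X: "X \<in> vector_fields A" and Y: "Y \<in> vector_fields A"
  let ?W = "W t1 t2 t3 t4" and ?N = "cov_deriv_endo nabla J X Y"
  have JW: "J (?W X Y) \<in> vector_fields A" and WJ: "?W X (J Y) \<in> vector_fields A"
    by (intro W J_closed X Y)+
  have N: "?N \<in> vector_fields A" by (rule cov_deriv_J_closed[OF X Y])
  \<comment> \<open>Since \<open>D\<close> is \<open>nabla\<close> plus \<open>W\<close>, the
    covariant derivative of J for \<open>D\<close> is \<open>?N + W(X,JY) - J W(X,Y)\<close>, so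
    this equation is the whole claim. Paired with Z it becomes \<open>S_J\<close>, as J is
    self-adjoint.\<close>
  have "?N = J (?W X Y) - ?W X (J Y)"
  proof (rule metric_cancel[OF g N vector_fields_diff[OF JW WJ]])
    fix Z assume Z: "Z \<in> vector_fields A"
    have "g (J (?W X Y) - ?W X (J Y)) Z p = F X Y Z p" for p
      using S_J[OF X Y Z]
      by (simp add: one_form_diff[OF metric_one_form(2)[OF g Z] JW WJ] g_J[OF W(1)[OF X Y] Z]
          W(2)[OF X Y J_closed[OF Z]] W(2)[OF X J_closed[OF Y] Z])
    then show "g ?N Z = g (J (?W X Y) - ?W X (J Y)) Z" by (simp add: fundamental_tensor_def fun_eq_iff)
  qed
  then show "cov_deriv_endo (D t1 t2 t3 t4) J X Y = 0"
    by (simp add: cov_deriv_endo_def D_def J_add nabla_closed W(1) X Y algebra_simps)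
qed

text \<open>As \<open>nabla\<close> is torsion-free, the torsion of \<open>D\<close> is the
  antisymmetrization in X and Y of the difference tensor.\<close>

lemma D_torsion:
  assumes X: "X \<in> vector_fields A" and Y: "Y \<in> vector_fields A" and Z: "Z \<in> vector_fields A"
  shows "g (torsion (D t1 t2 t3 t4) X Y) Z p =
    t1 * (F Y X Z p - F X Y Z p + F (J Y) (J X) Z p - F (J X) (J Y) Z p)
    + (1/2 - t2) * (F X (J Y) Z p - F Y (J X) Z p)
    + t2 * (F (J X) Y Z p - F (J Y) X Z p)
    + 2 * t3 * F (J Z) (J X) Y p
    + 2 * t4 * F Z (J X) Y p"
proof -
  let ?W = "W t1 t2 t3 t4"
  have "torsion nabla X Y = 0" using nabla X Y unfolding levi_civita_connection_def by blast
  moreover have "torsion (D t1 t2 t3 t4) X Y = torsion nabla X Y + (?W X Y - ?W Y X)"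
    by (simp add: torsion_def D_def)
  ultimately have "g (torsion (D t1 t2 t3 t4) X Y) Z p = S t1 t2 t3 t4 X Y Z p - S t1 t2 t3 t4 Y X Z p"
    by (simp add: one_form_diff[OF metric_one_form(2)[OF g Z] W(1)[OF X Y] W(1)[OF Y X]] W(2) X Y Z
        del: minus_apply)
  \<comment> \<open>With V = Z and V = JZ these identities settle the last two brackets: in each,
    the term without JX is symmetric in X and Y and cancels, while the term with JX is antisymmetric
    and doubles. This is the origin of the factors 2.\<close>
  moreover have "F V Y X p = F V X Y p" "F V (J Y) X p = - F V (J X) Y p"
    if V: "V \<in> vector_fields A" for V
    using F_symmetric[OF V Y X] F_symmetric[OF V J_closed[OF Y] X] F_J[OF V X Y] by simp_all
  ultimately show ?thesis
    using Z J_closed[OF Z] by (simp add: S_def algebra_simps)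
qed

end

theorem theorem2p1:
  fixes n :: nat
    and A :: "('a::{second_countable_topology, t2_space}, 'e::euclidean_space) chart set"
    and J :: "'a vfield \<Rightarrow> 'a vfield"
    and g :: "'a vfield \<Rightarrow> 'a vfield \<Rightarrow> 'a \<Rightarrow> real"
    and nabla :: "'a vfield \<Rightarrow> 'a vfield \<Rightarrow> 'a vfield"
    and F :: "'a vfield \<Rightarrow> 'a vfield \<Rightarrow> 'a vfield \<Rightarrow> 'a \<Rightarrow> real"
  assumes "almost_complex_norden_manifold n A J g"
    and "levi_civita_connection A g nabla"
    and F: "F = fundamental_tensor g J nabla"
  shows "\<exists>D :: real \<Rightarrow> real \<Rightarrow> real \<Rightarrow> real \<Rightarrow> 'a vfield \<Rightarrow> 'a vfield \<Rightarrow> 'a vfield.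
    \<forall>t1 t2 t3 t4.
      linear_connection A (D t1 t2 t3 t4) \<and>
      family_equation A g J nabla t1 t2 t3 t4 (D t1 t2 t3 t4) \<and>
      (\<forall>D'. (\<forall>X\<in>vector_fields A. \<forall>Y\<in>vector_fields A. D' X Y \<in> vector_fields A) \<and>
            family_equation A g J nabla t1 t2 t3 t4 D' \<longrightarrow>
        (\<forall>X\<in>vector_fields A. \<forall>Y\<in>vector_fields A. D' X Y = D t1 t2 t3 t4 X Y)) \<and>
      almost_complex_connection A J (D t1 t2 t3 t4) \<and>
      (\<forall>X\<in>vector_fields A. \<forall>Y\<in>vector_fields A. \<forall>Z\<in>vector_fields A. \<forall>p.
        g (torsion (D t1 t2 t3 t4) X Y) Z p =
          t1 * (F Y X Z p - F X Y Z p + F (J Y) (J X) Z p - F (J X) (J Y) Z p)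
          + (1/2 - t2) * (F X (J Y) Z p - F Y (J X) Z p)
          + t2 * (F (J X) Y Z p - F (J Y) X Z p)
          + 2 * t3 * F (J Z) (J X) Y p
          + 2 * t4 * F Z (J X) Y p)"
proof -
  interpret norden_manifold A J g nabla
    using assms(1,2) by unfold_locales (simp_all add: almost_complex_norden_manifold_def)
  show ?thesis
    unfolding F
    by (rule exI[of _ D])
      (intro allI conjI impI ballI D_linear_connection D_family_equation D_almost_complex D_torsion;
        (elim conjE)?; (rule D_unique)?; assumption)
qed

end
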